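(* Let $\Psi:\mathbb{T}^d_{\mathbf N}\to\mathfrak{H}_{+,m}$ be a given prior and let $\boldsymbol{\Sigma}=\{\Sigma_{\mathbf k}\}_{\mathbf k\in\Lambda}$, $\Sigma_{\mathbf k}\in\mathbb{C}^{m\times m}$, be given. Assume that $N_j>2n_j$ for $j=1,\dots,d$, and that (feasibility) there exists a function $\Phi_0:\mathbb{T}^d_{\mathbf N}\to\mathfrak{H}_{+,m}$ such that $$\int_{\mathbb{T}^d}e^{i\langle\mathbf k,\boldsymbol\theta\rangle}\Phi_0\,\mathrm{d}\nu_{\mathbf N}=\Sigma_{\mathbf k}\quad\text{for all }\mathbf k\in\Lambda.$$ Then the dual function $$J_\Psi(\mathbf Q)=\langle\mathbf Q,\boldsymbol\Sigma\rangle-\int_{\mathbb{T}^d}\log\det(\Psi^{-1}+Q)\,\mathrm{d}\nu_{\mathbf N}$$ has a unique minimizer $\mathbf Q^\circ$ over $\mathscr{L}_+$. Moreover, the function $\Phi^\circ:=(\Psi^{-1}+Q^\circ)^{-1}$ on $\mathbb{T}^d_{\mathbf N}$ solves the primal problem: minimize $$D_{\mathbf N}(\Phi,\Psi)=\int_{\mathbb{T}^d}\left(\log\det(\Phi^{-1}\Psi)+\operatorname{tr}[\Psi^{-1}(\Phi-\Psi)]\right)\mathrm{d}\nu_{\mathbf N}$$ over all functions $\Phi:\mathbb{T}^d_{\mathbf N}\to\mathfrak{H}_{+,m}$ subject to $\int_{\mathbb{T}^d}e^{i\langle\mathbf k,\boldsymbol\theta\rangle}\Phi\,\mathrm{d}\nu_{\mathbf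 N}=\Sigma_{\mathbf k}$ for all $\mathbf k\in\Lambda$.
   Context: Let $d,m\ge1$ be integers. $\mathfrak{H}_{+,m}$ is the set of $m\times m$ Hermitian positive definite complex matrices; $X>0$ means Hermitian positive definite; $(\cdot)^*$ is conjugate transpose. Fix positive integers $\mathbf N=(N_1,\dots,N_d)$, put $|\mathbf N|=\prod_j N_j$ and $\mathbb{Z}^d_{\mathbf N}=\{\boldsymbol\ell\in\mathbb{Z}^d:0\le\ell_j\le N_j-1,\ j=1,\dots,d\}$. The grid is $\mathbb{T}^d_{\mathbf N}=\{(2\pi\ell_1/N_1,\dots,2\pi\ell_d/N_d):\boldsymbol\ell\in\mathbb{Z}^d_{\mathbf N}\}$, and $\boldsymbol\zeta_{\boldsymbol\ell}=(e^{i2\pi\ell_1/N_1},\dots,e^{i2\pi\ell_d/N_d})$ is the corresponding point of the discrete torus; functions on the grid are written interchangeably as functions of $\boldsymbol\theta$, of $e^{i\boldsymbol\theta}=(e^{i\theta_1},\dots,e^{i\theta_d})$, or of $\boldsymbol\zeta_{\boldsymbol\ell}$. Integrals against $\nu_{\mathbf N}$ are the averages $\int_{\mathbb{T}^d}f(e^{i\boldsymbol\theta})\,\mathrm{d}\nu_{\mathbf N}=\frac1{|\mathbf N|}\sum_{\boldsymbol\ell\in\mathbb{Z}^d_{\mathbf N}}f(\boldsymbol\zeta_{\boldsymbol\ell})$. $\langle\mathbf k,\boldsymbol\theta\rangle=\sum_jk_j\theta_j$. $\Lambda\subset\mathbb{Z}^d$ is a finite index set with $\mathbf 0\in\Lambda$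 and $-\mathbf k\in\Lambda$ whenever $\mathbf k\in\Lambda$; $n_j:=\max\{|k_j|:\mathbf k\in\Lambda\}$. Lagrange multipliers are families $\mathbf Q=\{Q_{\mathbf k}\}_{\mathbf k\in\Lambda}$ with $Q_{\mathbf k}\in\mathbb{C}^{m\times m}$ and $Q_{-\mathbf k}=Q_{\mathbf k}^*$ (in particular $Q_{\mathbf 0}$ is Hermitian), with associated Hermitian-valued matrix trigonometric polynomial $Q(e^{i\boldsymbol\theta})=\sum_{\mathbf k\in\Lambda}Q_{\mathbf k}e^{-i\langle\mathbf k,\boldsymbol\theta\rangle}$ (and $Q^\circ$ is the polynomial associated with $\mathbf Q^\circ$). Put $\langle\mathbf Q,\boldsymbol\Sigma\rangle=\sum_{\mathbf k\in\Lambda}\operatorname{tr}(Q_{\mathbf k}\Sigma_{\mathbf k}^* )$ and $\mathscr{L}_+=\{\mathbf Q:(\Psi^{-1}+Q)(\boldsymbol\zeta_{\boldsymbol\ell})>0\ \ \forall\boldsymbol\ell\in\mathbb{Z}^d_{\mathbf N}\}$. *)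

theory Defs
  imports "HOL-Analysis.Analysis" "HOL-Library.FuncSet"
begin

definition conj_transpose :: "complex ^ 'n ^ 'm \<Rightarrow> complex ^ 'm ^ 'n" where
  "conj_transpose A = (\<chi> i j. cnj (A $ j $ i))"

definition hermitian :: "complex ^ 'n ^ 'n \<Rightarrow> bool" where
  "hermitian A \<longleftrightarrow> conj_transpose A = A"

text \<open>For Hermitian \<open>A\<close> the form \<open>x\<^sup>* A x\<close> is real, so taking its real part loses nothing.\<close>

definition pos_def :: "complex ^ 'n ^ 'n \<Rightarrow> bool" where
  "pos_def A \<longleftrightarrow> hermitian A \<and>
     (\<forall>x. x \<noteq> 0 \<longrightarrow> Re (\<Sum>i\<in>UNIV. cnj (x $ i) * (A *v x) $ i) > 0)"

definition cscale :: "complex \<Rightarrow> complex ^ 'n ^ 'm \<Rightarrow> complex ^ 'n ^ 'm" where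
  "cscale c A = (\<chi> i j. c * A $ i $ j)"

definition grid_index :: "nat ^ 'd \<Rightarrow> (int ^ 'd) set" where
  "grid_index N = {l. \<forall>j. 0 \<le> l $ j \<and> l $ j \<le> int (N $ j) - 1}"

definition grid_point :: "nat ^ 'd \<Rightarrow> int ^ 'd \<Rightarrow> real ^ 'd" where
  "grid_point N l = (\<chi> j. 2 * pi * of_int (l $ j) / of_nat (N $ j))"

text \<open>
  Functions on the discrete torus are functions of the angle vector; only their values on
  \<open>torus_grid N\<close> matter.
\<close>

definition torus_grid :: "nat ^ 'd \<Rightarrow> (real ^ 'd) set" where
  "torus_grid N = grid_point N ` grid_index N"

definition grid_avg :: "nat ^ 'd \<Rightarrow> (real ^ 'd \<Rightarrow> 'a::real_vector) \<Rightarrow> 'a" where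
  "grid_avg N f = (1 / real (\<Prod>j\<in>UNIV. N $ j)) *\<^sub>R (\<Sum>l\<in>grid_index N. f (grid_point N l))"

definition freq_pairing :: "int ^ 'd \<Rightarrow> real ^ 'd \<Rightarrow> real" where
  "freq_pairing k \<theta> = (\<Sum>j\<in>UNIV. of_int (k $ j) * \<theta> $ j)"

definition max_index :: "(int ^ 'd) set \<Rightarrow> 'd \<Rightarrow> int" where
  "max_index \<Lambda> j = Max {\<bar>k $ j\<bar> | k. k \<in> \<Lambda>}"

text \<open>
  Families indexed by \<open>\<Lambda>\<close> are functions with the fixed value \<open>undefined\<close> outside \<open>\<Lambda>\<close>, so that
  equality of functions is equality of families.
\<close>

definition multipliers :: "(int ^ 'd) set \<Rightarrow> (int ^ 'd \<Rightarrow> complex ^ 'm ^ 'm) set" where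
  "multipliers \<Lambda> = {Q \<in> extensional \<Lambda>. \<forall>k\<in>\<Lambda>. Q (- k) = conj_transpose (Q k)}"

definition trig_poly ::
  "(int ^ 'd) set \<Rightarrow> (int ^ 'd \<Rightarrow> complex ^ 'm ^ 'm) \<Rightarrow> real ^ 'd \<Rightarrow> complex ^ 'm ^ 'm" where
  "trig_poly \<Lambda> Q \<theta> = (\<Sum>k\<in>\<Lambda>. cscale (exp (- \<i> * of_real (freq_pairing k \<theta>))) (Q k))"

definition family_inner ::
  "(int ^ 'd) set \<Rightarrow> (int ^ 'd \<Rightarrow> complex ^ 'm ^ 'm) \<Rightarrow> (int ^ 'd \<Rightarrow> complex ^ 'm ^ 'm) \<Rightarrow> complex" where
  "family_inner \<Lambda> Q S = (\<Sum>k\<in>\<Lambda>. trace (Q k ** conj_transpose (S k)))"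

definition L_plus ::
  "(int ^ 'd) set \<Rightarrow> nat ^ 'd \<Rightarrow> (real ^ 'd \<Rightarrow> complex ^ 'm ^ 'm) \<Rightarrow> (int ^ 'd \<Rightarrow> complex ^ 'm ^ 'm) set"
  where
  "L_plus \<Lambda> N \<Psi> =
     {Q \<in> multipliers \<Lambda>. \<forall>\<theta>\<in>torus_grid N. pos_def (matrix_inv (\<Psi> \<theta>) + trig_poly \<Lambda> Q \<theta>)}"

definition feasible ::
  "(int ^ 'd) set \<Rightarrow> nat ^ 'd \<Rightarrow> (int ^ 'd \<Rightarrow> complex ^ 'm ^ 'm) \<Rightarrow> (real ^ 'd \<Rightarrow> complex ^ 'm ^ 'm) \<Rightarrow> bool"
  where
  "feasible \<Lambda> N S \<Phi> \<longleftrightarrow>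
     (\<forall>\<theta>\<in>torus_grid N. pos_def (\<Phi> \<theta>)) \<and>
     (\<forall>k\<in>\<Lambda>. grid_avg N (\<lambda>\<theta>. cscale (exp (\<i> * of_real (freq_pairing k \<theta>))) (\<Phi> \<theta>)) = S k)"

text \<open>
  The real parts below convert real complex numbers to type \<open>real\<close>: determinants of positive
  definite matrices and of products of two such matrices are positive reals, the trace of a
  product of two Hermitian matrices is real, and \<open>family_inner \<Lambda> Q S\<close> is real when
  \<open>Q\<close> and \<open>S\<close> both satisfy \<open>Q (- k) = conj_transpose (Q k)\<close> on a symmetric \<open>\<Lambda>\<close>, which
  \<open>feasible \<Lambda> N S \<Phi>\<close> forces for \<open>S\<close>.
\<close>

definition log_det :: "complex ^ 'n ^ 'n \<Rightarrow> real" where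
  "log_det A = ln (Re (det A))"

definition dual_fun ::
  "(int ^ 'd) set \<Rightarrow> nat ^ 'd \<Rightarrow> (real ^ 'd \<Rightarrow> complex ^ 'm ^ 'm) \<Rightarrow> (int ^ 'd \<Rightarrow> complex ^ 'm ^ 'm)
    \<Rightarrow> (int ^ 'd \<Rightarrow> complex ^ 'm ^ 'm) \<Rightarrow> real" where
  "dual_fun \<Lambda> N \<Psi> S Q =
     Re (family_inner \<Lambda> Q S) - grid_avg N (\<lambda>\<theta>. log_det (matrix_inv (\<Psi> \<theta>) + trig_poly \<Lambda> Q \<theta>))"

definition divergence ::
  "nat ^ 'd \<Rightarrow> (real ^ 'd \<Rightarrow> complex ^ 'm ^ 'm) \<Rightarrow> (real ^ 'd \<Rightarrow> complex ^ 'm ^ 'm) \<Rightarrow> real" where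
  "divergence N \<Phi> \<Psi> =
     grid_avg N (\<lambda>\<theta>. log_det (matrix_inv (\<Phi> \<theta>) ** \<Psi> \<theta>)
                      + Re (trace (matrix_inv (\<Psi> \<theta>) ** (\<Phi> \<theta> - \<Psi> \<theta>))))"

end

theory Submission imports Defs begin

text \<open>
  For a feasible \<open>\<Phi>\<close> the dual function only depends on \<open>A = \<Psi>\<^sup>-\<^sup>1 + Q\<close> on the grid, and
  divergence plus dual function is a constant plus the grid average of the nonnegative quantity
  \<open>tr (A \<Phi>) - log det A - log det \<Phi> - m\<close>, which vanishes only for \<open>\<Phi> = A\<^sup>-\<^sup>1\<close>. Hence, as soon
  as \<open>A\<^sup>-\<^sup>1\<close> is feasible for a dual minimizer, it is primally optimal, and any other dual minimizer
  has the same \<open>A\<close>, hence the same \<open>Q\<close> by Fourier inversion on the grid (which needs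
  \<open>N\<^sub>j > 2 n\<^sub>j\<close>). Feasibility of \<open>A\<^sup>-\<^sup>1\<close> is stationarity of the dual function in the direction of
  the moment defect. A minimizer exists because a bound on the dual function bounds \<open>tr A\<close> from
  above and \<open>det A\<close> away from zero, so that sublevel sets are compact.

  The inequality \<open>tr (A \<Phi>) - log det A - log det \<Phi> \<ge> m\<close> reduces by \<open>\<Phi> = L\<^sup>* L\<close> to the case
  \<open>\<Phi> = 1\<close>, which is proved by clearing the rows and columns of \<open>A\<close> one at a time.
\<close>

section \<open>Positive definite matrices\<close>

lemma conj_transpose_nth [simp]: "conj_transpose A $ i $ j = cnj (A $ j $ i)"
  by (simp add: conj_transpose_def)

lemma conj_transpose_mult: "conj_transpose (A ** B) = conj_transpose B ** conj_transpose A"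
  by (simp add: vec_eq_iff matrix_matrix_mult_def mult.commute)

lemma conj_transpose_conj_transpose [simp]: "conj_transpose (conj_transpose A) = A"
  by (simp add: vec_eq_iff)

lemma conj_transpose_add: "conj_transpose (A + B) = conj_transpose A + conj_transpose B"
  by (simp add: vec_eq_iff)

lemma conj_transpose_scaleR: "conj_transpose (c *\<^sub>R A) = c *\<^sub>R conj_transpose A"
  by (simp add: vec_eq_iff)

lemma conj_transpose_diff: "conj_transpose (A - B) = conj_transpose A - conj_transpose B"
  by (simp add: vec_eq_iff)

lemma conj_transpose_sum: "conj_transpose (sum f S) = (\<Sum>x\<in>S. conj_transpose (f x))"
  by (induction S rule: infinite_finite_induct) (auto simp: conj_transpose_add vec_eq_iff)

lemma conj_transpose_mat_1 [simp]: "conj_transpose (mat 1) = mat 1"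
  by (simp add: vec_eq_iff mat_def)

lemma det_conj_transpose: "det (conj_transpose A) = cnj (det A)"
proof -
  have "det (conj_transpose A) = det (transpose (conj_transpose A))"
    by simp
  also have "\<dots> = cnj (det A)"
    by (simp add: det_def transpose_def)
  finally show ?thesis .
qed

lemma invertible_conj_transpose:
  fixes A :: "complex ^ 'n ^ 'n"
  assumes "invertible A" shows "invertible (conj_transpose A)"
  using assms by (simp add: invertible_det_nz det_conj_transpose)

definition quad_form :: "complex ^ 'n ^ 'n \<Rightarrow> complex ^ 'n \<Rightarrow> real" where
  "quad_form A x = Re (\<Sum>i\<in>UNIV. cnj (x $ i) * (A *v x) $ i)"

lemma pos_def_quad_form: "pos_def A \<longleftrightarrow> hermitian A \<and> (\<forall>x. x \<noteq> 0 \<longrightarrow> quad_form A x > 0)"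
  by (simp add: pos_def_def quad_form_def)

lemma conj_transpose_adjoint:
  "(\<Sum>i\<in>UNIV. cnj (x $ i) * (conj_transpose F *v y) $ i) = (\<Sum>i\<in>UNIV. cnj ((F *v x) $ i) * y $ i)"
proof -
  have "(\<Sum>i\<in>UNIV. cnj (x $ i) * (conj_transpose F *v y) $ i)
      = (\<Sum>i\<in>UNIV. \<Sum>j\<in>UNIV. cnj (x $ i) * (cnj (F $ j $ i) * y $ j))"
    by (simp add: matrix_vector_mult_def sum_distrib_left)
  also have "\<dots> = (\<Sum>j\<in>UNIV. \<Sum>i\<in>UNIV. cnj (x $ i) * (cnj (F $ j $ i) * y $ j))"
    by (rule sum.swap)
  also have "\<dots> = (\<Sum>i\<in>UNIV. cnj ((F *v x) $ i) * y $ i)"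
    by (simp add: matrix_vector_mult_def sum_distrib_right sum_distrib_left mult_ac)
  finally show ?thesis .
qed

lemma quad_form_congruence: "quad_form (conj_transpose F ** A ** F) x = quad_form A (F *v x)"
  by (simp add: quad_form_def conj_transpose_adjoint
      flip: matrix_vector_mul_assoc matrix_mul_assoc)

lemma quad_form_mat_1: "quad_form (mat 1) x = (norm x)\<^sup>2"
  by (simp add: quad_form_def norm_vec_def L2_set_def sum_nonneg cmod_def power2_eq_square)

lemma quad_form_add: "quad_form (A + B) x = quad_form A x + quad_form B x"
  by (simp add: quad_form_def matrix_vector_mult_add_rdistrib distrib_left sum.distrib)

lemma quad_form_diff: "quad_form (A - B) x = quad_form A x - quad_form B x"
  by (simp add: quad_form_def matrix_vector_mult_diff_rdistrib right_diff_distrib sum_subtractf)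

lemma quad_form_scaleR: "quad_form (c *\<^sub>R A) x = c * quad_form A x"
  by (simp add: quad_form_def matrix_vector_mult_def sum_distrib_left scaleR_sum_right mult_ac)

lemma quad_form_axis: "quad_form A (axis i 1) = Re (A $ i $ i)"
proof -
  have "(\<Sum>k\<in>UNIV. cnj (axis i 1 $ k) * (A *v axis i 1) $ k)
     = (\<Sum>k\<in>UNIV. if k = i then A $ k $ i else 0)"
    by (intro sum.cong) (auto simp: matrix_vector_mult_def axis_def if_distrib cong: if_cong)
  then show ?thesis by (simp add: quad_form_def)
qed

lemma hermitian_congruence:
  "hermitian A \<Longrightarrow> hermitian (conj_transpose F ** A ** F)"
  by (simp add: hermitian_def conj_transpose_mult matrix_mul_assoc)

lemma pos_def_congruence:
  fixes A F :: "complex ^ 'n ^ 'n"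
  assumes "pos_def A" "invertible F"
  shows "pos_def (conj_transpose F ** A ** F)"
proof -
  have "F *v x \<noteq> 0" if "x \<noteq> 0" for x
  proof
    assume "F *v x = 0"
    then have "F *v x = F *v 0" by simp
    with inj_matrix_vector_mult[OF assms(2)] that show False
      by (meson injD)
  qed
  then show ?thesis
    using assms by (simp add: pos_def_quad_form hermitian_congruence quad_form_congruence)
qed

lemma pos_def_mat_1: "pos_def (mat 1)"
  by (simp add: pos_def_quad_form hermitian_def quad_form_mat_1)

lemma hermitian_nth: "hermitian A \<Longrightarrow> cnj (A $ i $ j) = A $ j $ i"
  by (metis conj_transpose_nth hermitian_def)

lemma pos_def_diagonal:
  assumes "pos_def A"
  shows "Re (A $ i $ i) > 0" and "A $ i $ i = of_real (Re (A $ i $ i))"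
proof -
  show "Re (A $ i $ i) > 0"
    using assms unfolding pos_def_quad_form by (metis axis_eq_0_iff quad_form_axis zero_neq_one)
  show "A $ i $ i = of_real (Re (A $ i $ i))"
    using hermitian_nth[of A i i] assms by (simp add: pos_def_def complex_eq_iff)
qed

section \<open>Symmetric elimination and Schur complements\<close>

text \<open>
  Clearing row and column \<open>a\<close> of a positive definite matrix by the congruence with
  \<open>clearing_matrix a G\<close> leaves the Schur complement of the entry \<open>(a, a)\<close>, bordered by a
  row and a column of the identity matrix.
\<close>

definition clearing_matrix :: "'n \<Rightarrow> complex ^ 'n ^ 'n \<Rightarrow> complex ^ 'n ^ 'n" where
  "clearing_matrix a G = (\<chi> i j. if i = a then
       (if j = a then 1 / of_real (sqrt (Re (G $ a $ a))) else - G $ a $ j / G $ a $ a)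
     else if i = j then 1 else 0)"

definition cleared :: "'n \<Rightarrow> complex ^ 'n ^ 'n \<Rightarrow> complex ^ 'n ^ 'n" where
  "cleared a G = conj_transpose (clearing_matrix a G) ** G ** clearing_matrix a G"

text \<open>The clearing matrix is the identity with row \<open>a\<close> replaced. Transposed, it
  is the identity with one column replaced, and \<open>cramer_lemma\<close> for \<open>mat 1\<close>
  reads off the replaced diagonal entry.\<close>

lemma det_clearing_matrix:
  fixes G :: "complex ^ 'n ^ 'n"
  shows "det (clearing_matrix a G) = 1 / of_real (sqrt (Re (G $ a $ a)))"
proof -
  define r :: "complex ^ 'n" where "r = clearing_matrix a G $ a"
  have "clearing_matrix a G = transpose (\<chi> i j. if j = a then r $ i else mat 1 $ i $ j)"
    by (auto simp: vec_eq_iff transpose_def r_def clearing_matrix_def mat_def)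
  then have "det (clearing_matrix a G) = r $ a * det (mat 1 :: complex ^ 'n ^ 'n)"
    using cramer_lemma[of a "mat 1" r] by (simp only: det_transpose matrix_vector_mul_lid)
  then show ?thesis
    by (simp add: r_def clearing_matrix_def)
qed

lemma sum_two_cases:
  fixes f :: "'n::finite \<Rightarrow> 'a::comm_monoid_add"
  assumes "a \<noteq> j" "\<And>k. k \<noteq> a \<Longrightarrow> k \<noteq> j \<Longrightarrow> f k = 0"
  shows "sum f UNIV = f a + f j"
proof -
  have "sum f UNIV = sum f {a, j}"
    using assms by (intro sum.mono_neutral_right) auto
  then show ?thesis using assms by simp
qed

lemma sum_one_case:
  fixes f :: "'n::finite \<Rightarrow> 'a::comm_monoid_add"
  assumes "\<And>k. k \<noteq> a \<Longrightarrow> f k = 0"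
  shows "sum f UNIV = f a"
proof -
  have "sum f UNIV = sum f {a}"
    using assms by (intro sum.mono_neutral_right) auto
  then show ?thesis by simp
qed

text \<open>Since the clearing matrix differs from the identity only in row \<open>a\<close>, each
  sum in the two matrix products has at most two nonzero terms.\<close>

lemma cleared_nth:
  fixes G :: "complex ^ 'n ^ 'n"
  assumes "pos_def G"
  shows "cleared a G $ i $ j =
    (if i = a \<or> j = a then (if i = j then 1 else 0) else G $ i $ j - G $ i $ a * G $ a $ j / G $ a $ a)"
proof -
  define g where "g = Re (G $ a $ a)"
  have g: "g > 0" "G $ a $ a = of_real g"
    using pos_def_diagonal[OF assms, of a] by (auto simp: g_def)
  have s: "complex_of_real (sqrt g) * complex_of_real (sqrt g) = of_real g"
    using g(1) by (simp flip: of_real_mult)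
  have her: "cnj (G $ i $ j) = G $ j $ i" for i j
    using assms by (simp add: pos_def_def hermitian_nth)
  let ?F = "clearing_matrix a G"
  \<comment> \<open>The column operations alone: column \<open>a\<close> is rescaled, and a multiple
    of it is subtracted from every other column.\<close>
  define H where "H = G ** ?F"
  have H: "H $ i $ j = (if j = a then G $ i $ a / of_real (sqrt g)
      else G $ i $ j - G $ i $ a * G $ a $ j / g)" for i j
  proof (cases "j = a")
    case True
    then show ?thesis
      unfolding H_def matrix_matrix_mult_def
      by (simp add: clearing_matrix_def sum_one_case[of a] g_def)
  next
    case False
    have "H $ i $ j = G $ i $ a * ?F $ a $ j + G $ i $ j * ?F $ j $ j"
      unfolding H_def matrix_matrix_mult_def vec_lambda_beta
      using False by (intro sum_two_cases) (auto simp: clearing_matrix_def)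
    then show ?thesis using False g by (simp add: clearing_matrix_def)
  qed
  have C: "cleared a G $ i $ j = (\<Sum>k\<in>UNIV. cnj (?F $ k $ i) * H $ k $ j)"
  proof -
    have "cleared a G = conj_transpose ?F ** H"
      by (simp add: cleared_def H_def matrix_mul_assoc)
    then show ?thesis by (simp add: matrix_matrix_mult_def)
  qed
  show ?thesis
  proof (cases "i = a")
    case True
    have "cleared a G $ i $ j = cnj (?F $ a $ i) * H $ a $ j"
      unfolding C using True by (intro sum_one_case) (auto simp: clearing_matrix_def)
    then show ?thesis
      using True g s by (auto simp: clearing_matrix_def H divide_divide_eq_left simp flip: g_def)
  next
    case False
    have "cleared a G $ i $ j = cnj (?F $ a $ i) * H $ a $ j + cnj (?F $ i $ i) * H $ i $ j"
      unfolding C using False by (intro sum_two_cases) (auto simp: clearing_matrix_def)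
    then show ?thesis
      using False g by (auto simp: clearing_matrix_def H her)
  qed
qed

lemma invertible_clearing_matrix:
  assumes "pos_def G" shows "invertible (clearing_matrix a G)"
  using pos_def_diagonal[OF assms, of a] by (simp add: invertible_det_nz det_clearing_matrix)

lemma pos_def_cleared: "pos_def G \<Longrightarrow> pos_def (cleared a G)"
  unfolding cleared_def by (intro pos_def_congruence invertible_clearing_matrix)

text \<open>Induction on a finite set \<open>I\<close> outside of which \<open>G\<close> already
  agrees with the identity. Clearing some \<open>a\<close> in \<open>I\<close> removes it from
  \<open>I\<close> without disturbing the rows and columns cleared before. The start
  \<open>I = UNIV\<close> imposes no condition on \<open>G\<close>.\<close>

lemma pos_def_induct [consumes 1, case_names mat_1 clear]:
  fixes G :: "complex ^ 'n ^ 'n"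
  assumes "pos_def G"
    and "P (mat 1)"
    and "\<And>G a. pos_def G \<Longrightarrow> pos_def (cleared a G) \<Longrightarrow> P (cleared a G) \<Longrightarrow> P G"
  shows "P G"
proof -
  have "P G" if "finite I" "pos_def G" "\<And>i j. i \<notin> I \<or> j \<notin> I \<Longrightarrow> G $ i $ j = mat 1 $ i $ j"
    for I :: "'n set" and G
    using that
  proof (induction I arbitrary: G rule: finite_induct)
    case empty
    then have "G = mat 1" by (simp add: vec_eq_iff)
    then show ?case using assms(2) by simp
  next
    case (insert a I)
    show ?case
    proof (rule assms(3))
      show "P (cleared a G)"
      proof (rule insert.IH)
        fix i j assume "i \<notin> I \<or> j \<notin> I"
        \<comment> \<open>Clearing settles row and column \<open>a\<close>. If instead
          \<open>i\<close> or \<open>j\<close> lies outside \<open>insert a I\<close>, then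
          \<open>G $ i $ a\<close> or \<open>G $ a $ j\<close> is already zero, so the Schur
          correction vanishes.\<close>
        then show "cleared a G $ i $ j = mat 1 $ i $ j"
          using insert.prems(2)[of i j] insert.prems(2)[of i a] insert.prems(2)[of a j]
          by (auto simp: cleared_nth[OF insert.prems(1)] mat_def)
      qed (use insert.prems pos_def_cleared in auto)
    qed (use insert.prems pos_def_cleared in auto)
  qed
  from this[of UNIV G] assms(1) show ?thesis by simp
qed

text \<open>A Cholesky-type factorization: a factor of the cleared matrix, multiplied on the right
  by the inverse \<open>E\<close> of the clearing matrix, is a factor of \<open>G\<close>.\<close>

lemma pos_def_factorization:
  fixes G :: "complex ^ 'n ^ 'n"
  assumes "pos_def G"
  obtains L :: "complex ^ 'n ^ 'n" where "invertible L" "G = conj_transpose L ** L"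
proof -
  have "\<exists>L :: complex ^ 'n ^ 'n. invertible L \<and> G = conj_transpose L ** L"
    using assms
  proof (induction rule: pos_def_induct)
    case mat_1
    show ?case by (rule exI[of _ "mat 1"]) (simp add: invertible_det_nz)
  next
    case (clear G a)
    then obtain L :: "complex ^ 'n ^ 'n" where L: "invertible L" "cleared a G = conj_transpose L ** L" by blast
    obtain E where E: "clearing_matrix a G ** E = mat 1" "E ** clearing_matrix a G = mat 1"
      using invertible_clearing_matrix[OF clear(1), of a] unfolding invertible_def by blast
    have "conj_transpose (L ** E) ** (L ** E) = conj_transpose E ** cleared a G ** E"
      by (simp add: L(2) conj_transpose_mult matrix_mul_assoc)
    also have "\<dots> = conj_transpose (clearing_matrix a G ** E) ** G ** (clearing_matrix a G ** E)"
      by (simp add: cleared_def conj_transpose_mult matrix_mul_assoc)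
    finally have "G = conj_transpose (L ** E) ** (L ** E)"
      by (simp add: E)
    moreover have "invertible (L ** E)"
      using L(1) E by (metis invertible_def invertible_mult)
    ultimately show ?case by blast
  qed
  then show thesis using that by blast
qed

section \<open>Determinants of positive definite matrices and the trace inequality\<close>

lemma det_conj_transpose_mult_self: "det (conj_transpose L ** L) = of_real ((cmod (det L))\<^sup>2)"
  by (simp add: det_mul det_conj_transpose complex_norm_square mult.commute del: of_real_power)

lemma pos_def_det:
  fixes A :: "complex ^ 'n ^ 'n"
  assumes "pos_def A"
  shows "Re (det A) > 0" and "det A = of_real (Re (det A))"
proof -
  obtain L :: "complex ^ 'n ^ 'n" where L: "invertible L" "A = conj_transpose L ** L"
    using pos_def_factorization[OF assms] .
  show "Re (det A) > 0" "det A = of_real (Re (det A))"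
    using L by (simp_all add: det_conj_transpose_mult_self invertible_det_nz del: of_real_power)
qed

lemma pos_def_invertible:
  fixes A :: "complex ^ 'n ^ 'n"
  shows "pos_def A \<Longrightarrow> invertible A"
  using pos_def_det(1)[of A] by (force simp: invertible_det_nz)

lemma log_det_congruence:
  fixes A F :: "complex ^ 'n ^ 'n"
  assumes "pos_def A" "invertible F"
  shows "log_det (conj_transpose F ** A ** F) = log_det A + ln ((cmod (det F))\<^sup>2)"
proof -
  have "det (conj_transpose F ** A ** F) = of_real (Re (det A) * (cmod (det F))\<^sup>2)"
    using pos_def_det(2)[OF assms(1)]
    by (simp add: det_mul det_conj_transpose complex_norm_square mult_ac del: of_real_power)
  then have "Re (det (conj_transpose F ** A ** F)) = Re (det A) * (cmod (det F))\<^sup>2"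
    by (simp del: of_real_mult)
  then show ?thesis
    using pos_def_det(1)[OF assms(1)] assms(2)
    by (simp add: log_det_def ln_mult invertible_det_nz)
qed

text \<open>Clearing divides the determinant by the pivot \<open>g\<close>, replaces the diagonal
  entry \<open>g\<close> by 1, and lowers every other diagonal entry by its Schur
  correction.\<close>

lemma trace_minus_log_det_cleared:
  fixes G :: "complex ^ 'n ^ 'n" and a :: 'n
  assumes "pos_def G"
  defines "g \<equiv> Re (G $ a $ a)"
  shows "Re (trace G) - log_det G = Re (trace (cleared a G)) - log_det (cleared a G)
      + (g - 1 - ln g) + (\<Sum>i\<in>UNIV - {a}. (cmod (G $ i $ a))\<^sup>2 / g)"
proof -
  have g: "g > 0" "G $ a $ a = of_real g"
    using pos_def_diagonal[OF assms(1), of a] by (auto simp: g_def)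
  have "log_det (cleared a G) = log_det G + ln ((cmod (det (clearing_matrix a G)))\<^sup>2)"
    unfolding cleared_def by (intro log_det_congruence assms invertible_clearing_matrix)
  also have "(cmod (det (clearing_matrix a G)))\<^sup>2 = 1 / g"
    using g by (simp add: det_clearing_matrix norm_divide power_divide flip: g_def)
  finally have ld: "log_det (cleared a G) = log_det G - ln g"
    using g by (simp add: ln_div)
  have e: "Re (cleared a G $ i $ i) = Re (G $ i $ i) - (cmod (G $ i $ a))\<^sup>2 / g" if "i \<noteq> a" for i
  proof -
    have "G $ a $ i = cnj (G $ i $ a)"
      using assms by (simp add: pos_def_def hermitian_nth)
    then have "G $ i $ a * G $ a $ i / G $ a $ a = of_real ((cmod (G $ i $ a))\<^sup>2 / g)"
      using g by (simp add: complex_norm_square[symmetric] flip: of_real_power)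
    then show ?thesis
      using that by (simp add: cleared_nth[OF assms(1)])
  qed
  have "Re (trace (cleared a G)) = 1 + (\<Sum>i\<in>UNIV-{a}. Re (cleared a G $ i $ i))"
    by (simp add: trace_def sum.remove[of UNIV a] cleared_nth[OF assms(1)])
  also have "(\<Sum>i\<in>UNIV-{a}. Re (cleared a G $ i $ i)) =
     (\<Sum>i\<in>UNIV-{a}. Re (G $ i $ i)) - (\<Sum>i\<in>UNIV-{a}. (cmod (G $ i $ a))\<^sup>2 / g)"
    unfolding sum_subtractf[symmetric] by (intro sum.cong) (auto simp: e)
  also have "(\<Sum>i\<in>UNIV-{a}. Re (G $ i $ i)) = Re (trace G) - g"
    by (simp add: trace_def sum.remove[of UNIV a] g_def)
  finally show ?thesis using ld by simp
qed

text \<open>Each clearing step lowers the left side by two nonnegative amounts, ending at the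
  identity. Equality forces both to vanish: the pivot is 1 because \<open>ln g = g - 1\<close> only
  there, and the rest of the column is zero.\<close>

lemma trace_minus_log_det:
  fixes G :: "complex ^ 'n ^ 'n"
  assumes "pos_def G"
  shows "Re (trace G) - log_det G \<ge> CARD('n)"
    and "Re (trace G) - log_det G = CARD('n) \<Longrightarrow> G = mat 1"
proof -
  have "Re (trace G) - log_det G \<ge> CARD('n)
    \<and> (Re (trace G) - log_det G = CARD('n) \<longrightarrow> G = mat 1)"
    using assms
  proof (induction rule: pos_def_induct)
    case mat_1
    show ?case by (simp add: trace_I log_det_def)
  next
    case (clear G a)
    define g where "g = Re (G $ a $ a)"
    have g: "g > 0" "G $ a $ a = of_real g"
      using pos_def_diagonal[OF clear(1), of a] by (auto simp: g_def)
    have 1: "g - 1 - ln g \<ge> 0"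
      using ln_le_minus_one[OF g(1)] by simp
    have 2: "(\<Sum>i\<in>UNIV - {a}. (cmod (G $ i $ a))\<^sup>2 / g) \<ge> 0"
      using g by (intro sum_nonneg) auto
    note eq = trace_minus_log_det_cleared[OF clear(1), of a, folded g_def]
    have "G = mat 1" if "Re (trace G) - log_det G = CARD('n)"
    proof -
      have *: "g - 1 - ln g = 0" "(\<Sum>i\<in>UNIV - {a}. (cmod (G $ i $ a))\<^sup>2 / g) = 0"
        "cleared a G = mat 1"
        using that eq 1 2 clear.IH by linarith+
      have "g = 1" using *(1) ln_eq_minus_one[OF g(1)] by simp
      have col: "G $ i $ a = 0" if "i \<noteq> a" for i
        using *(2) that g by (subst (asm) sum_nonneg_eq_0_iff) auto
      have row: "G $ a $ i = 0" if "i \<noteq> a" for i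
        using col[OF that] hermitian_nth[of G i a] clear(1) by (simp add: pos_def_def)
      have "G $ i $ j = mat 1 $ i $ j" for i j
      proof (cases "i = a \<or> j = a")
        case True
        then show ?thesis using col row g \<open>g = 1\<close> by (auto simp: mat_def)
      next
        case False
        then have "cleared a G $ i $ j = G $ i $ j"
          by (simp add: cleared_nth[OF clear(1)] col)
        then show ?thesis using *(3) by simp
      qed
      then show ?thesis by (simp add: vec_eq_iff)
    qed
    then show ?case using eq 1 2 clear.IH by linarith
  qed
  then show "Re (trace G) - log_det G \<ge> CARD('n)"
    "Re (trace G) - log_det G = CARD('n) \<Longrightarrow> G = mat 1" by auto
qed

lemma trace_mult_minus_log_dets:
  fixes A B :: "complex ^ 'n ^ 'n"
  assumes "pos_def A" "pos_def B"
  shows "Re (trace (A ** B)) - log_det A - log_det B \<ge> CARD('n)"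
    and "Re (trace (A ** B)) - log_det A - log_det B = CARD('n) \<Longrightarrow> A ** B = mat 1"
proof -
  obtain L :: "complex ^ 'n ^ 'n" where L: "invertible L" "B = conj_transpose L ** L"
    using pos_def_factorization[OF assms(2)] .
  define F where "F = conj_transpose L"
  have F: "invertible F" "B = F ** conj_transpose F"
    using L by (auto simp: F_def invertible_conj_transpose)
  define G where "G = conj_transpose F ** A ** F"
  have G: "pos_def G"
    unfolding G_def by (intro pos_def_congruence assms F)
  have "log_det B = ln ((cmod (det F))\<^sup>2)"
    using log_det_congruence[OF pos_def_mat_1 L(1)] L
    by (simp add: log_det_def F_def det_conj_transpose)
  then have ld: "log_det G = log_det A + log_det B"
    unfolding G_def using log_det_congruence[OF assms(1) F(1)] by simp
  have tr: "trace G = trace (A ** B)"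
    unfolding G_def F(2) by (metis matrix_mul_assoc trace_mul_sym)
  show "Re (trace (A ** B)) - log_det A - log_det B \<ge> CARD('n)"
    using trace_minus_log_det(1)[OF G] by (simp add: ld tr)
  assume "Re (trace (A ** B)) - log_det A - log_det B = CARD('n)"
  then have "G = mat 1"
    using trace_minus_log_det(2)[OF G] by (simp add: ld tr)
  \<comment> \<open>For square matrices a left inverse is a right inverse, which brings the factors
    into the order \<open>A ** B\<close>.\<close>
  then have "conj_transpose F ** (A ** F) = mat 1"
    by (simp add: G_def matrix_mul_assoc)
  then have "(A ** F) ** conj_transpose F = mat 1"
    using matrix_left_right_inverse by blast
  then show "A ** B = mat 1"
    by (simp add: F(2) matrix_mul_assoc)
qed

section \<open>Inverses and the concavity of log det\<close>

lemma matrix_diff_ldistrib: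
  fixes A :: "complex ^ 'n ^ 'm"
  shows "A ** (B - C) = A ** B - A ** C"
  by (simp add: vec_eq_iff matrix_matrix_mult_def right_diff_distrib sum_subtractf)

lemma trace_scaleR:
  fixes A :: "complex ^ 'n ^ 'n"
  shows "trace (c *\<^sub>R A) = c *\<^sub>R trace A"
  by (simp add: trace_def scaleR_sum_right)

lemma matrix_vector_mult_scaleR_complex:
  fixes A :: "complex ^ 'n ^ 'm"
  shows "A *v (c *\<^sub>R x) = c *\<^sub>R (A *v x)"
  by (simp add: vec_eq_iff matrix_vector_mult_def scaleR_sum_right)

lemma matrix_mult_scaleR_right:
  fixes A :: "complex ^ 'n ^ 'm"
  shows "A ** (c *\<^sub>R B) = c *\<^sub>R (A ** B)"
  by (simp add: vec_eq_iff matrix_matrix_mult_def scaleR_sum_right)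

lemma pos_def_hermitian: "pos_def A \<Longrightarrow> hermitian A"
  by (simp add: pos_def_def)

lemma hermitian_add: "hermitian A \<Longrightarrow> hermitian B \<Longrightarrow> hermitian (A + B)"
  by (simp add: hermitian_def conj_transpose_add)

lemma hermitian_scaleR: "hermitian A \<Longrightarrow> hermitian (c *\<^sub>R A)"
  by (simp add: hermitian_def conj_transpose_scaleR)

lemma matrix_inv_mult:
  fixes A :: "complex ^ 'n ^ 'n"
  assumes "invertible A"
  shows "A ** matrix_inv A = mat 1" "matrix_inv A ** A = mat 1"
  using someI_ex[OF assms[unfolded invertible_def]] by (simp_all add: matrix_inv_def)

lemma matrix_inv_unique:
  fixes A B :: "complex ^ 'n ^ 'n"
  assumes "A ** B = mat 1"
  shows "matrix_inv A = B"
proof -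
  have "invertible A"
    using assms by (auto simp: invertible_right_inverse)
  then have "matrix_inv A = matrix_inv A ** (A ** B)"
    by (simp add: assms)
  also have "\<dots> = B"
    by (simp add: matrix_mul_assoc matrix_inv_mult[OF \<open>invertible A\<close>])
  finally show ?thesis .
qed

text \<open>Once the inverse is known to be Hermitian, it is the congruence of \<open>A\<close> by
  itself: \<open>A\<^sup>-\<^sup>1 A A\<^sup>-\<^sup>1 = A\<^sup>-\<^sup>1\<close>.\<close>

lemma pos_def_matrix_inv:
  fixes A :: "complex ^ 'n ^ 'n"
  assumes "pos_def A"
  shows "pos_def (matrix_inv A)"
proof -
  note inv = matrix_inv_mult[OF pos_def_invertible[OF assms]]
  have her: "conj_transpose (matrix_inv A) = matrix_inv A"
  proof -
    have "conj_transpose (matrix_inv A ** A) = mat 1"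
      by (simp add: inv)
    then have "A ** conj_transpose (matrix_inv A) = mat 1"
      using pos_def_hermitian[OF assms] by (simp add: conj_transpose_mult hermitian_def)
    then show ?thesis
      by (rule matrix_inv_unique[symmetric])
  qed
  have "invertible (matrix_inv A)"
    using inv by (auto simp: invertible_def)
  from pos_def_congruence[OF assms this] show ?thesis
    by (simp add: her inv)
qed

lemma log_det_mult:
  fixes A B :: "complex ^ 'n ^ 'n"
  assumes "pos_def A" "pos_def B"
  shows "log_det (A ** B) = log_det A + log_det B"
proof -
  have "det (A ** B) = of_real (Re (det A) * Re (det B))"
    using pos_def_det(2)[OF assms(1)] pos_def_det(2)[OF assms(2)] by (simp add: det_mul)
  then show ?thesis
    using pos_def_det(1)[OF assms(1)] pos_def_det(1)[OF assms(2)]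
    by (simp add: log_det_def ln_mult)
qed

lemma log_det_matrix_inv:
  fixes A :: "complex ^ 'n ^ 'n"
  assumes "pos_def A"
  shows "log_det (matrix_inv A) = - log_det A"
  using log_det_mult[OF assms pos_def_matrix_inv[OF assms]]
  by (simp add: matrix_inv_mult pos_def_invertible[OF assms]) (simp add: log_det_def)

lemma matrix_inv_matrix_inv:
  fixes A :: "complex ^ 'n ^ 'n"
  assumes "pos_def A"
  shows "matrix_inv (matrix_inv A) = A"
  by (intro matrix_inv_unique matrix_inv_mult pos_def_invertible assms)

text \<open>Concavity of log det in tangent form, obtained without differentiation from the trace
  inequality for \<open>A\<close> and \<open>matrix_inv X\<close>.\<close>

lemma log_det_supergradient:
  fixes A X :: "complex ^ 'n ^ 'n"
  assumes "pos_def A" "pos_def X"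
  shows "log_det A - log_det X \<le> Re (trace (matrix_inv X ** (A - X)))"
proof -
  have "CARD('n) \<le> Re (trace (A ** matrix_inv X)) - log_det A + log_det X"
    using trace_mult_minus_log_dets(1)[OF assms(1) pos_def_matrix_inv[OF assms(2)]]
    by (simp add: log_det_matrix_inv assms)
  moreover have "trace (matrix_inv X ** (A - X)) = trace (matrix_inv X ** A) - trace (matrix_inv X ** X)"
    by (simp add: trace_sub[symmetric] matrix_diff_ldistrib)
  ultimately show ?thesis
    by (simp add: trace_mul_sym[of A] matrix_inv_mult pos_def_invertible assms trace_I)
qed

lemma trace_pos:
  fixes A :: "complex ^ 'n ^ 'n"
  assumes "pos_def A"
  shows "Re (trace A) > 0"
  using pos_def_diagonal(1)[OF assms] by (simp add: trace_def sum_pos)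

text \<open>With \<open>B = L\<^sup>* L\<close>, cyclicity turns the trace into that of the
  congruent matrix \<open>L A L\<^sup>*\<close>.\<close>

lemma trace_mult_pos:
  fixes A B :: "complex ^ 'n ^ 'n"
  assumes "pos_def A" "pos_def B"
  shows "Re (trace (A ** B)) > 0"
proof -
  obtain L :: "complex ^ 'n ^ 'n" where L: "invertible L" "B = conj_transpose L ** L"
    using pos_def_factorization[OF assms(2)] .
  have "pos_def (conj_transpose (conj_transpose L) ** A ** conj_transpose L)"
    by (intro pos_def_congruence assms invertible_conj_transpose L)
  moreover have "trace (conj_transpose (conj_transpose L) ** A ** conj_transpose L) = trace (A ** B)"
    unfolding L(2) by (metis conj_transpose_conj_transpose matrix_mul_assoc trace_mul_sym)
  ultimately show ?thesis
    using trace_pos by metis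
qed

section \<open>Bounds, perturbation and coercivity\<close>

lemma norm_matrix_le_sum:
  fixes A :: "complex ^ 'n ^ 'm"
  shows "norm A \<le> (\<Sum>i\<in>UNIV. \<Sum>j\<in>UNIV. cmod (A $ i $ j))"
proof -
  have "norm A \<le> (\<Sum>i\<in>UNIV. norm (A $ i))"
    unfolding norm_vec_def[of A] by (rule L2_set_le_sum) simp
  also have "\<dots> \<le> (\<Sum>i\<in>UNIV. \<Sum>j\<in>UNIV. cmod (A $ i $ j))"
    unfolding norm_vec_def by (intro sum_mono L2_set_le_sum) simp
  finally show ?thesis .
qed

text \<open>The entry \<open>(i, j)\<close> is the inner product of two columns of \<open>L\<close>.
  By the arithmetic-geometric mean inequality it is at most the mean of two diagonal entries, which
  are nonnegative parts of the trace.\<close>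

lemma pos_def_nth_le_trace:
  fixes A :: "complex ^ 'n ^ 'n"
  assumes "pos_def A"
  shows "cmod (A $ i $ j) \<le> Re (trace A)"
proof -
  obtain L :: "complex ^ 'n ^ 'n" where L: "invertible L" "A = conj_transpose L ** L"
    using pos_def_factorization[OF assms] .
  have d: "Re (A $ i $ i) = (\<Sum>k\<in>UNIV. (cmod (L $ k $ i))\<^sup>2)" for i
    unfolding L(2) by (simp add: matrix_matrix_mult_def cmod_power2) (simp add: power2_eq_square)
  have le: "Re (A $ i $ i) \<le> Re (trace A)" for i
    unfolding trace_def Re_sum using pos_def_diagonal(1)[OF assms]
    by (intro member_le_sum) (auto intro: less_imp_le)
  have "cmod (A $ i $ j) \<le> (\<Sum>k\<in>UNIV. cmod (L $ k $ i) * cmod (L $ k $ j))"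
    unfolding L(2) matrix_matrix_mult_def
    by (auto intro!: order_trans[OF norm_sum] simp: norm_mult)
  also have "\<dots> \<le> (\<Sum>k\<in>UNIV. ((cmod (L $ k $ i))\<^sup>2 + (cmod (L $ k $ j))\<^sup>2) / 2)"
  proof (intro sum_mono)
    fix k
    show "cmod (L $ k $ i) * cmod (L $ k $ j) \<le> ((cmod (L $ k $ i))\<^sup>2 + (cmod (L $ k $ j))\<^sup>2) / 2"
      using sum_squares_bound[of "cmod (L $ k $ i)" "cmod (L $ k $ j)"] by simp
  qed
  also have "\<dots> = (Re (A $ i $ i) + Re (A $ j $ j)) / 2"
    by (simp add: d sum.distrib flip: sum_divide_distrib)
  also have "\<dots> \<le> Re (trace A)"
    using le[of i] le[of j] by simp
  finally show ?thesis .
qed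

lemma pos_def_norm_le_trace:
  fixes A :: "complex ^ 'n ^ 'n"
  assumes "pos_def A"
  shows "norm A \<le> (real CARD('n))\<^sup>2 * Re (trace A)"
proof -
  have "norm A \<le> (\<Sum>i\<in>(UNIV::'n set). \<Sum>j\<in>(UNIV::'n set). Re (trace A))"
    by (rule order_trans[OF norm_matrix_le_sum]) (intro sum_mono pos_def_nth_le_trace assms)
  then show ?thesis by (simp add: power2_eq_square)
qed

lemma continuous_on_quad_form: "continuous_on S (quad_form A)"
  unfolding quad_form_def matrix_vector_mult_def
  by (auto intro!: continuous_intros)

lemma quad_form_scaleR_right: "quad_form A (c *\<^sub>R x) = c\<^sup>2 * quad_form A x"
  by (simp add: quad_form_def matrix_vector_mult_scaleR_complex scaleR_conv_of_real[where 'a = complex]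
      sum_distrib_left power2_eq_square mult_ac)

text \<open>The constant is the minimum of the form on the unit sphere, extended by homogeneity. The
  bound is stated for every matrix, with \<open>c\<close> possibly negative, because perturbation
  directions are indefinite.\<close>

lemma quad_form_lower_bound:
  fixes A :: "complex ^ 'n ^ 'n"
  obtains c where "\<And>x. quad_form A x \<ge> c * (norm x)\<^sup>2" "pos_def A \<Longrightarrow> c > 0"
proof -
  have "compact (sphere (0 :: complex ^ 'n) 1)" "sphere (0 :: complex ^ 'n) 1 \<noteq> {}"
    by (simp_all)
  from continuous_attains_inf[OF this continuous_on_quad_form[of _ A]]
  obtain u where u: "norm u = 1" and min: "\<And>x. norm x = 1 \<Longrightarrow> quad_form A u \<le> quad_form A x"
    by (auto simp: dist_norm)
  show thesis
  proof
    fix x :: "complex ^ 'n"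
    show "quad_form A x \<ge> quad_form A u * (norm x)\<^sup>2"
    proof (cases "x = 0")
      case True
      then show ?thesis by (simp add: quad_form_def)
    next
      case False
      then have "quad_form A u \<le> quad_form A ((1 / norm x) *\<^sub>R x)"
        by (intro min) simp
      then show ?thesis
        using False by (simp add: quad_form_scaleR_right field_simps)
    qed
    show "quad_form A u > 0" if "pos_def A"
      proof -
      have "u \<noteq> 0" using u by auto
      then show ?thesis using that by (simp add: pos_def_quad_form)
    qed
  qed
qed

lemma eventually_pos_def_perturbation:
  assumes "pos_def A" "hermitian B"
  shows "eventually (\<lambda>t. pos_def (A + t *\<^sub>R B)) (at_right 0)"
proof -
  obtain a where a: "\<And>x. quad_form A x \<ge> a * (norm x)\<^sup>2" "a > 0"
    using quad_form_lower_bound[of A] assms(1) by metis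
  obtain b where b: "\<And>x. quad_form B x \<ge> b * (norm x)\<^sup>2"
    using quad_form_lower_bound[of B] by metis
  have "((\<lambda>t. a + t * b) \<longlongrightarrow> a + 0 * b) (at_right 0)"
    by (intro tendsto_intros)
  then have "eventually (\<lambda>t. a + t * b > 0) (at_right 0)"
    using a(2) by (intro order_tendstoD(1)) auto
  moreover have "eventually (\<lambda>t::real. t > 0) (at_right 0)"
    by (simp add: eventually_at_right_less)
  ultimately show ?thesis
  proof eventually_elim
    case (elim t)
    have "quad_form (A + t *\<^sub>R B) x > 0" if "x \<noteq> 0" for x
    proof -
      have "0 < (a + t * b) * (norm x)\<^sup>2"
        using elim that by simp
      also have "\<dots> = a * (norm x)\<^sup>2 + t * (b * (norm x)\<^sup>2)"
        by (simp add: algebra_simps)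
      also have "\<dots> \<le> quad_form A x + t * quad_form B x"
        using elim by (intro add_mono a(1) mult_left_mono b) simp
      finally show ?thesis by (simp add: quad_form_add quad_form_scaleR)
    qed
    then show ?case
      using assms by (simp add: pos_def_quad_form hermitian_add hermitian_scaleR)
  qed
qed

text \<open>Half of the lower bound \<open>c\<close> can be split off from \<Phi>, leaving a
  positive definite \<open>\<Phi>'\<close>. The trace inequality for \<open>\<Phi>'\<close> gives
  the constant, and the part split off gives the multiple of the trace of \<open>A\<close>.\<close>

lemma trace_minus_log_det_coercive:
  fixes \<Phi> :: "complex ^ 'n ^ 'n"
  assumes "pos_def \<Phi>"
  obtains \<epsilon> b where "\<epsilon> > 0"
    "\<And>A. pos_def A \<Longrightarrow> Re (trace (A ** \<Phi>)) - log_det A \<ge> b + \<epsilon> * Re (trace A)"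
proof -
  obtain c where c: "\<And>x. quad_form \<Phi> x \<ge> c * (norm x)\<^sup>2" "c > 0"
    using quad_form_lower_bound[of \<Phi>] assms by metis
  define \<Phi>' where "\<Phi>' = \<Phi> - (c/2) *\<^sub>R mat 1"
  have "quad_form \<Phi>' x > 0" if "x \<noteq> 0" for x
  proof -
    have "0 < c / 2 * (norm x)\<^sup>2" using c that by simp
    then show ?thesis
      using c(1)[of x] by (simp add: \<Phi>'_def quad_form_diff quad_form_scaleR quad_form_mat_1)
  qed
  moreover have "hermitian \<Phi>'"
    using pos_def_hermitian[OF assms]
    by (simp add: \<Phi>'_def hermitian_def conj_transpose_diff conj_transpose_scaleR)
  ultimately have pd: "pos_def \<Phi>'"
    by (simp add: pos_def_quad_form)
  show thesis
  proof
    show "c / 2 > 0" using c by simp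
    fix A :: "complex ^ 'n ^ 'n" assume A: "pos_def A"
    have "A ** \<Phi>' = A ** \<Phi> - (c/2) *\<^sub>R A"
      by (simp add: \<Phi>'_def matrix_diff_ldistrib matrix_mult_scaleR_right)
    then have "Re (trace (A ** \<Phi>')) = Re (trace (A ** \<Phi>)) - c / 2 * Re (trace A)"
      by (simp add: trace_sub trace_scaleR)
    then show "Re (trace (A ** \<Phi>)) - log_det A \<ge> (CARD('n) + log_det \<Phi>') + c / 2 * Re (trace A)"
      using trace_mult_minus_log_dets(1)[OF A pd] by simp
  qed
qed

text \<open>
  If the form of \<open>A\<close> vanished at \<open>x \<noteq> 0\<close>, then its first variation \<open>2 (norm (A x))\<^sup>2\<close> in the
  direction \<open>A x\<close> would have to vanish as well.
\<close>

lemma pos_def_of_psd_nonsingular: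
  fixes A :: "complex ^ 'n ^ 'n"
  assumes her: "hermitian A" and psd: "\<And>x. quad_form A x \<ge> 0" and "det A \<noteq> 0"
  shows "pos_def A"
proof -
  have "quad_form A x \<noteq> 0" if "x \<noteq> 0" for x
  proof
    assume 0: "quad_form A x = 0"
    define y where "y = A *v x"
    define q where "q = quad_form A y"
    have "y \<noteq> 0"
    proof
      assume "y = 0"
      then have "A *v x = A *v 0" by (simp add: y_def)
      with inj_matrix_vector_mult[of A] assms(3) that show False
        by (metis injD invertible_det_nz)
    qed
    have nsq: "Re (\<Sum>i\<in>UNIV. cnj (y $ i) * y $ i) = (norm y)\<^sup>2"
      using quad_form_mat_1[of y] by (simp add: quad_form_def)
    have sym: "(\<Sum>i\<in>UNIV. cnj (x $ i) * (A *v y) $ i) = (\<Sum>i\<in>UNIV. cnj (y $ i) * y $ i)"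
      using conj_transpose_adjoint[of x A y] her by (simp add: hermitian_def y_def)
    define ip where "ip u v = (\<Sum>i\<in>UNIV. cnj (u $ i) * v $ i)" for u v :: "complex ^ 'n"
    have ip: "ip (u + v) w = ip u w + ip v w" "ip u (v + w) = ip u v + ip u w"
      "ip (t *\<^sub>R u) v = of_real t * ip u v" "ip u (t *\<^sub>R v) = of_real t * ip u v" for u v w t
      unfolding ip_def
      by (simp_all add: distrib_left distrib_right sum.distrib sum_distrib_left scaleR_conv_of_real[where 'a = complex] mult_ac)
    have exp: "quad_form A (x + t *\<^sub>R y) = 2 * t * (norm y)\<^sup>2 + t\<^sup>2 * q" for t
    proof -
      have "ip (x + t *\<^sub>R y) (A *v (x + t *\<^sub>R y)) =
        ip x (A *v x) + of_real t * ip x (A *v y) + of_real t * ip y y + of_real (t\<^sup>2) * ip y (A *v y)"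
        by (simp add: ip matrix_vector_right_distrib matrix_vector_mult_scaleR_complex distrib_left
            power2_eq_square flip: y_def)
      moreover have "ip x (A *v y) = ip y y"
        using sym by (simp add: ip_def)
      moreover have "quad_form A v = Re (ip v (A *v v))" for v
        by (simp add: quad_form_def ip_def)
      moreover have "Re (ip y y) = (norm y)\<^sup>2"
        using nsq by (simp add: ip_def)
      ultimately show ?thesis
        using 0 by (simp add: q_def flip: of_real_power)
    qed
    define N where "N = (norm y)\<^sup>2"
    have "N > 0" using \<open>y \<noteq> 0\<close> by (simp add: N_def)
    have "q \<ge> 0" using psd by (simp add: q_def)
    \<comment> \<open>Small enough that at parameter \<open>- s\<close> the quadratic term cannot
      outweigh the linear one: the form there is at most \<open>- s * N\<close>, which is negative.
      The added 1 covers \<open>q = 0\<close>.\<close>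
    define s where "s = N / (q + 1)"
    have "s > 0" using \<open>N > 0\<close> \<open>q \<ge> 0\<close> by (simp add: s_def)
    have "s * q \<le> N"
      using \<open>N > 0\<close> \<open>q \<ge> 0\<close> by (simp add: s_def field_simps)
    then have "s * (s * q) \<le> s * N"
      using \<open>s > 0\<close> by (intro mult_left_mono) auto
    moreover have "s * N > 0" using \<open>s > 0\<close> \<open>N > 0\<close> by simp
    moreover have "0 \<le> 2 * (- s) * N + (- s)\<^sup>2 * q"
      using psd[of "x + (- s) *\<^sub>R y"] by (simp only: exp N_def)
    ultimately show False
      by (simp add: power2_eq_square)
  qed
  then show ?thesis
    using psd her by (simp add: pos_def_quad_form order.not_eq_order_implies_strict)
qed

section \<open>Continuity of the determinant and of inversion\<close>

lemma tendsto_det: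
  fixes f :: "'a \<Rightarrow> complex ^ 'n ^ 'n"
  assumes "\<And>i j. ((\<lambda>x. f x $ i $ j) \<longlongrightarrow> A $ i $ j) F"
  shows "((\<lambda>x. det (f x)) \<longlongrightarrow> det A) F"
  unfolding det_def
  by (rule tendsto_sum, rule tendsto_mult, rule tendsto_const, rule tendsto_prod, rule assms)

lemma continuous_on_det:
  fixes f :: "'a::topological_space \<Rightarrow> complex ^ 'n ^ 'n"
  assumes "continuous_on S f"
  shows "continuous_on S (\<lambda>x. det (f x))"
  unfolding det_def
  by (rule continuous_on_sum, rule continuous_on_mult, rule continuous_on_const,
      rule continuous_on_prod, rule continuous_on_component, rule continuous_on_component, rule assms)

text \<open>Cramer's rule applied to the columns of the inverse. It exhibits each entry as a
  quotient of determinants, from which continuity of inversion follows.\<close>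

lemma matrix_inv_nth:
  fixes A :: "complex ^ 'n ^ 'n"
  assumes "det A \<noteq> 0"
  shows "matrix_inv A $ k $ l = det (\<chi> i j. if j = k then axis l 1 $ i else A $ i $ j) / det A"
proof -
  have "A *v (matrix_inv A *v axis l 1) = axis l 1"
    using matrix_inv_mult(1)[of A] assms by (simp add: matrix_vector_mul_assoc invertible_det_nz)
  then have "matrix_inv A *v axis l 1 =
      (\<chi> k. det (\<chi> i j. if j = k then axis l 1 $ i else A $ i $ j) / det A)"
    by (rule iffD1[OF cramer[OF assms]])
  then have "(matrix_inv A *v axis l 1) $ k =
      det (\<chi> i j. if j = k then axis l 1 $ i else A $ i $ j) / det A"
    by (simp only: vec_lambda_beta)
  moreover have "(matrix_inv A *v axis l 1) $ k = matrix_inv A $ k $ l"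
    by (simp add: matrix_vector_mult_def axis_def if_distrib cong: if_cong)
  ultimately show ?thesis by simp
qed

lemma tendsto_matrix_inv:
  fixes f :: "'a \<Rightarrow> complex ^ 'n ^ 'n"
  assumes "(f \<longlongrightarrow> A) F" "det A \<noteq> 0"
  shows "((\<lambda>x. matrix_inv (f x)) \<longlongrightarrow> matrix_inv A) F"
proof (rule vec_tendstoI, rule vec_tendstoI)
  fix k l
  have nth: "((\<lambda>x. f x $ i $ j) \<longlongrightarrow> A $ i $ j) F" for i j
    by (intro tendsto_vec_nth assms)
  have det: "((\<lambda>x. det (f x)) \<longlongrightarrow> det A) F"
    by (rule tendsto_det) (rule nth)
  have "((\<lambda>x. det (\<chi> i j. if j = k then axis l 1 $ i else f x $ i $ j))
    \<longlongrightarrow> det (\<chi> i j. if j = k then axis l 1 $ i else A $ i $ j)) F"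
  proof (rule tendsto_det)
    fix i j
    show "((\<lambda>x. (\<chi> i j. if j = k then axis l 1 $ i else f x $ i $ j) $ i $ j)
      \<longlongrightarrow> (\<chi> i j. if j = k then axis l 1 $ i else A $ i $ j) $ i $ j) F"
      by (cases "j = k") (simp_all add: nth)
  qed
  from tendsto_divide[OF this det assms(2)]
  have lim: "((\<lambda>x. det (\<chi> i j. if j = k then axis l 1 $ i else f x $ i $ j) / det (f x))
    \<longlongrightarrow> matrix_inv A $ k $ l) F"
    by (simp only: matrix_inv_nth[OF assms(2)])
  \<comment> \<open>Cramer's formula describes the inverse only where the determinant is nonzero,
    which holds eventually.\<close>
  have "eventually (\<lambda>x. det (f x) \<noteq> 0) F"
    by (rule tendsto_imp_eventually_ne[OF det assms(2)])
  then have "eventually (\<lambda>x. det (\<chi> i j. if j = k then axis l 1 $ i else f x $ i $ j) / det (f x)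
      = matrix_inv (f x) $ k $ l) F"
    by eventually_elim (rule matrix_inv_nth[symmetric])
  with lim show "((\<lambda>x. matrix_inv (f x) $ k $ l) \<longlongrightarrow> matrix_inv A $ k $ l) F"
    by (rule Lim_transform_eventually)
qed

section \<open>Fourier analysis on the grid\<close>

lemma cscale_nth [simp]: "cscale c A $ i $ j = c * A $ i $ j"
  by (simp add: cscale_def)

lemma conj_transpose_cscale: "conj_transpose (cscale c A) = cscale (cnj c) (conj_transpose A)"
  by (simp add: vec_eq_iff)

lemma cscale_mult_left: "cscale c A ** B = cscale c (A ** B)"
  by (simp add: vec_eq_iff matrix_matrix_mult_def sum_distrib_left mult.assoc)

lemma cscale_mult_right: "A ** cscale c B = cscale c (A ** B)"
  by (simp add: vec_eq_iff matrix_matrix_mult_def sum_distrib_left mult.left_commute)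

lemma trace_cscale: "trace (cscale c A) = c * trace A"
  by (simp add: trace_def sum_distrib_left)

lemma trace_sum: "trace (\<Sum>x\<in>S. f x :: complex ^ 'n ^ 'n) = (\<Sum>x\<in>S. trace (f x))"
  by (induction S rule: infinite_finite_induct) (auto simp: trace_add trace_0[simplified mat_0])

lemma matrix_sum_mult_left:
  "(\<Sum>x\<in>S. f x :: complex ^ 'n ^ 'm) ** (B :: complex ^ 'k ^ 'n) = (\<Sum>x\<in>S. f x ** B)"
  by (induction S rule: infinite_finite_induct)
    (auto simp: vec_eq_iff matrix_matrix_mult_def distrib_right sum.distrib)

lemma norm_cscale: "norm (cscale c A) = cmod c * norm A"
  by (simp add: norm_vec_def norm_mult L2_set_left_distrib L2_set_right_distrib)

section \<open>Frequencies, characters and grid averages\<close>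

lemma freq_pairing_diff: "freq_pairing (k - l) \<theta> = freq_pairing k \<theta> - freq_pairing l \<theta>"
  by (simp add: freq_pairing_def left_diff_distrib sum_subtractf)

lemma freq_pairing_minus: "freq_pairing (- k) \<theta> = - freq_pairing k \<theta>"
  by (simp add: freq_pairing_def sum_negf)

text \<open>Describes the grid as a product of integer intervals, so that finiteness and the
  expansion of a product of sums come from \<open>PiE\<close>.\<close>

lemma grid_index_eq_image:
  "grid_index N = vec_lambda ` (PiE UNIV (\<lambda>j. {0..<int (N $ j)}))"
proof -
  have "l \<in> vec_lambda ` (PiE UNIV (\<lambda>j. {0..<int (N $ j)}))" if "l \<in> grid_index N" for l
    using that by (intro image_eqI[of _ _ "vec_nth l"]) (auto simp: grid_index_def)
  then show ?thesis by (auto simp: grid_index_def PiE_iff)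
qed

lemma inj_on_vec_lambda: "inj_on vec_lambda A"
  by (auto simp: inj_on_def vec_lambda_inject)

lemma finite_grid_index: "finite (grid_index N)"
  unfolding grid_index_eq_image by (intro finite_imageI finite_PiE) auto

lemma finite_torus_grid: "finite (torus_grid N)"
  by (simp add: torus_grid_def finite_grid_index)

lemma sum_grid_index_prod:
  fixes f :: "'d::finite \<Rightarrow> int \<Rightarrow> complex"
  shows "(\<Sum>l\<in>grid_index N. \<Prod>j\<in>UNIV. f j (l $ j)) = (\<Prod>j\<in>UNIV. \<Sum>x=0..<int (N $ j). f j x)"
  unfolding grid_index_eq_image
  by (simp add: sum.reindex[OF inj_on_vec_lambda] prod_sum_PiE)

text \<open>A geometric sum of an \<open>n\<close>-th root of unity \<open>w\<close>. If
  \<open>w = 1\<close> then \<open>n\<close> divides \<open>r\<close>, which the bound on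
  \<open>r\<close> allows only for \<open>r = 0\<close>.\<close>

lemma sum_roots_of_unity:
  assumes "n > 0" "\<bar>r\<bar> < int n"
  shows "(\<Sum>x=0..<int n. exp (\<i> * of_real (of_int r * (2 * pi * of_int x / of_nat n))))
    = (if r = 0 then of_nat n else 0)"
proof (cases "r = 0")
  case True
  then show ?thesis by simp
next
  case False
  define w where "w = exp (\<i> * of_real (of_int r * (2 * pi / of_nat n)))"
  have pow: "w ^ k = exp (\<i> * of_real (of_int r * (2 * pi * of_int (int k) / of_nat n)))" for k
    unfolding w_def exp_of_nat_mult[symmetric] by (simp add: field_simps)
  have "w ^ n = exp (\<i> * of_real (of_int r * (2 * pi)))"
    unfolding pow using assms by simp
  also have "\<dots> = 1"
    by (auto simp: exp_eq_1 intro!: exI[of _ r])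
  finally have wn: "w ^ n = 1" .
  have "w \<noteq> 1"
  proof
    assume "w = 1"
    then obtain q :: int where "of_int r * (2 * pi / of_nat n) = of_int (2 * q) * pi"
      unfolding w_def exp_eq_1 by auto
    then have "real_of_int r = of_int q * of_nat n"
      using assms by (simp add: field_simps)
    then have "r = q * int n"
      by (metis of_int_eq_iff of_int_mult of_int_of_nat_eq)
    with assms False show False
      by (metis abs_mult abs_of_nat dvd_triv_right zdvd_not_zless zero_less_abs_iff)
  qed
  have "(\<Sum>x=0..<int n. exp (\<i> * of_real (of_int r * (2 * pi * of_int x / of_nat n))))
     = (\<Sum>k<n. w ^ k)"
    unfolding pow
    by (rule sum.reindex_bij_witness[of _ int nat]) auto
  also have "\<dots> = 0"
    using \<open>w \<noteq> 1\<close> wn by (simp add: geometric_sum)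
  finally show ?thesis using False by simp
qed

lemma sum_grid_characters:
  fixes N :: "nat ^ 'd" and r :: "int ^ 'd"
  assumes "\<And>j. N $ j > 0" "\<And>j. \<bar>r $ j\<bar> < int (N $ j)"
  shows "(\<Sum>l\<in>grid_index N. exp (\<i> * of_real (freq_pairing r (grid_point N l))))
    = (if r = 0 then of_nat (\<Prod>j\<in>UNIV. N $ j) else 0)"
proof -
  have "(\<Sum>l\<in>grid_index N. exp (\<i> * of_real (freq_pairing r (grid_point N l))))
    = (\<Sum>l\<in>grid_index N. \<Prod>j\<in>UNIV. exp (\<i> * of_real (of_int (r $ j) * (2 * pi * of_int (l $ j) / of_nat (N $ j)))))"
    by (simp add: freq_pairing_def grid_point_def sum_distrib_left exp_sum)
  also have "\<dots> = (\<Prod>j\<in>UNIV. if r $ j = 0 then of_nat (N $ j) else 0)"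
    unfolding sum_grid_index_prod[where f = "\<lambda>j x. exp (\<i> * of_real (of_int (r $ j) * (2 * pi * of_int x / of_nat (N $ j))))"]
    by (intro prod.cong sum_roots_of_unity assms refl)
  also have "\<dots> = (if r = 0 then of_nat (\<Prod>j\<in>UNIV. N $ j) else 0)"
    by (auto simp: vec_eq_iff)
  finally show ?thesis .
qed

lemma grid_avg_linear:
  assumes "linear h"
  shows "h (grid_avg N f) = grid_avg N (\<lambda>\<theta>. h (f \<theta>))"
  by (simp add: grid_avg_def linear_sum[OF assms] linear_scale[OF assms])

lemma grid_avg_cong:
  "(\<And>\<theta>. \<theta> \<in> torus_grid N \<Longrightarrow> f \<theta> = g \<theta>) \<Longrightarrow> grid_avg N f = grid_avg N g"
  unfolding grid_avg_def torus_grid_def by (intro arg_cong2[of _ _ _ _ scaleR] sum.cong) auto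

lemma grid_avg_sum: "grid_avg N (\<lambda>\<theta>. \<Sum>k\<in>A. f k \<theta>) = (\<Sum>k\<in>A. grid_avg N (f k))"
  unfolding grid_avg_def scaleR_sum_right[symmetric] by (subst sum.swap) simp

lemma grid_avg_add: "grid_avg N (\<lambda>\<theta>. f \<theta> + g \<theta>) = grid_avg N f + grid_avg N g"
  by (simp add: grid_avg_def sum.distrib scaleR_add_right)

lemma grid_avg_diff: "grid_avg N (\<lambda>\<theta>. f \<theta> - g \<theta>) = grid_avg N f - grid_avg N g"
  by (simp add: grid_avg_def sum_subtractf scaleR_diff_right)

lemma grid_avg_mono:
  fixes f g :: "real ^ 'd \<Rightarrow> real"
  assumes "\<And>\<theta>. \<theta> \<in> torus_grid N \<Longrightarrow> f \<theta> \<le> g \<theta>"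
  shows "grid_avg N f \<le> grid_avg N g"
  unfolding grid_avg_def real_scaleR_def using assms
  by (intro mult_left_mono sum_mono) (auto simp: torus_grid_def prod_nonneg)

text \<open>One term of a nonnegative sum is at most the whole sum; this converts bounds on averages
  into bounds at every grid point.\<close>

lemma grid_avg_member_le:
  fixes f :: "real ^ 'd \<Rightarrow> real"
  assumes "\<And>\<theta>. \<theta> \<in> torus_grid N \<Longrightarrow> f \<theta> \<ge> 0" "\<And>j. N $ j > 0" "\<theta> \<in> torus_grid N"
  shows "f \<theta> \<le> real (\<Prod>j\<in>UNIV. N $ j) * grid_avg N f"
proof -
  have "(\<Prod>j\<in>UNIV. N $ j) > 0"
    using assms(2) by (simp add: prod_pos)
  then have "real (\<Prod>j\<in>UNIV. N $ j) * grid_avg N f = (\<Sum>l\<in>grid_index N. f (grid_point N l))"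
    unfolding grid_avg_def by (simp del: of_nat_prod)
  moreover obtain l where "l \<in> grid_index N" "\<theta> = grid_point N l"
    using assms(3) by (auto simp: torus_grid_def)
  moreover have "f (grid_point N l) \<le> (\<Sum>l\<in>grid_index N. f (grid_point N l))" if "l \<in> grid_index N"
    using that assms(1) finite_grid_index
    by (intro member_le_sum[of l "grid_index N" "\<lambda>l. f (grid_point N l)"]) (auto simp: torus_grid_def)
  ultimately show ?thesis by simp
qed

lemma grid_avg_eq_0:
  fixes f :: "real ^ 'd \<Rightarrow> real"
  assumes "\<And>\<theta>. \<theta> \<in> torus_grid N \<Longrightarrow> f \<theta> \<ge> 0" "\<And>j. N $ j > 0" "\<theta> \<in> torus_grid N"
    and "grid_avg N f = 0"
  shows "f \<theta> = 0"
  using grid_avg_member_le[of N f \<theta>] assms by force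

lemma norm_grid_avg_le: "norm (grid_avg N f) \<le> grid_avg N (\<lambda>\<theta>. norm (f \<theta>))"
  unfolding grid_avg_def norm_scaleR real_scaleR_def
  by (simp del: of_nat_prod add: divide_right_mono norm_sum)

lemma max_index_bound:
  assumes "finite \<Lambda>" "k \<in> \<Lambda>"
  shows "\<bar>k $ j\<bar> \<le> max_index \<Lambda> j"
proof -
  have "{\<bar>k $ j\<bar> | k. k \<in> \<Lambda>} = (\<lambda>k. \<bar>k $ j\<bar>) ` \<Lambda>" by auto
  then show ?thesis
    unfolding max_index_def using assms by simp
qed

text \<open>Two frequencies in \<Lambda> differ in coordinate \<open>j\<close> by at most
  \<open>2 * max_index \<Lambda> j\<close>, which is less than \<open>N $ j\<close>. Hence distinct
  ones are not aliased and their characters are orthogonal on the grid.\<close>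

lemma fourier_inversion:
  fixes N :: "nat ^ 'd" and Q :: "int ^ 'd \<Rightarrow> complex ^ 'm ^ 'm"
  assumes "finite \<Lambda>" "\<And>j. N $ j > 0" "\<And>j. int (N $ j) > 2 * max_index \<Lambda> j" "k \<in> \<Lambda>"
  shows "grid_avg N (\<lambda>\<theta>. cscale (exp (\<i> * of_real (freq_pairing k \<theta>))) (trig_poly \<Lambda> Q \<theta>)) = Q k"
proof -
  have char: "grid_avg N (\<lambda>\<theta>. exp (\<i> * of_real (freq_pairing (k - l) \<theta>))) = (if l = k then 1 else 0)"
    if "l \<in> \<Lambda>" for l
  proof -
    have "\<bar>(k - l) $ j\<bar> < int (N $ j)" for j
      using max_index_bound[OF assms(1,4), of j] max_index_bound[OF assms(1) that, of j]
        assms(3)[of j] by simp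
    moreover define p where "p = (\<Prod>j\<in>UNIV. N $ j)"
    moreover have "p > 0"
      using assms(2) by (simp add: p_def prod_pos)
    ultimately show ?thesis
      unfolding grid_avg_def p_def[symmetric]
      by (subst sum_grid_characters[OF assms(2), folded p_def]) (auto simp: scaleR_conv_of_real)
  qed
  have lin: "linear (\<lambda>z. cscale z A)" for A :: "complex ^ 'm ^ 'm"
    by (rule linearI) (auto simp: vec_eq_iff distrib_right)
  have "cscale (exp (\<i> * of_real (freq_pairing k \<theta>))) (trig_poly \<Lambda> Q \<theta>)
      = (\<Sum>l\<in>\<Lambda>. cscale (exp (\<i> * of_real (freq_pairing (k - l) \<theta>))) (Q l))" for \<theta>
    by (simp add: vec_eq_iff trig_poly_def sum_distrib_left freq_pairing_diff
        right_diff_distrib exp_diff exp_minus field_simps)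
  then have "grid_avg N (\<lambda>\<theta>. cscale (exp (\<i> * of_real (freq_pairing k \<theta>))) (trig_poly \<Lambda> Q \<theta>))
    = (\<Sum>l\<in>\<Lambda>. grid_avg N (\<lambda>\<theta>. cscale (exp (\<i> * of_real (freq_pairing (k - l) \<theta>))) (Q l)))"
    by (simp only: grid_avg_sum)
  also have "\<dots> = (\<Sum>l\<in>\<Lambda>. cscale (if l = k then 1 else 0) (Q l))"
    by (intro sum.cong refl) (simp only: grid_avg_linear[OF lin, symmetric] char)
  also have "\<dots> = (\<Sum>l\<in>\<Lambda>. if l = k then Q l else 0)"
    by (intro sum.cong) (auto simp: vec_eq_iff)
  also have "\<dots> = Q k"
    using assms by simp
  finally show ?thesis .
qed

text \<open>Conjugation sends the term of \<open>k\<close> to that of \<open>- k\<close>, so the sum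
  is merely reindexed.\<close>

lemma hermitian_trig_poly:
  assumes "finite \<Lambda>" "\<And>k. k \<in> \<Lambda> \<Longrightarrow> - k \<in> \<Lambda>" "Q \<in> multipliers \<Lambda>"
  shows "hermitian (trig_poly \<Lambda> Q \<theta>)"
proof -
  have "conj_transpose (trig_poly \<Lambda> Q \<theta>)
      = (\<Sum>k\<in>\<Lambda>. cscale (exp (\<i> * of_real (freq_pairing k \<theta>))) (Q (- k)))"
    using assms(3)
    by (simp add: trig_poly_def conj_transpose_sum conj_transpose_cscale exp_cnj multipliers_def)
  also have "\<dots> = trig_poly \<Lambda> Q \<theta>"
    unfolding trig_poly_def
    by (rule sum.reindex_bij_witness[of _ uminus uminus]) (auto simp: assms(2) freq_pairing_minus)
  finally show ?thesis by (simp add: hermitian_def)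
qed

text \<open>Moments of Hermitian functions have the symmetry required of multipliers, so differences
  of moment families can serve as search directions.\<close>

lemma feasible_uminus:
  assumes "feasible \<Lambda> N S \<Phi>" "k \<in> \<Lambda>" "- k \<in> \<Lambda>"
  shows "S (- k) = conj_transpose (S k)"
proof -
  have lin: "linear (conj_transpose :: complex ^ 'm ^ 'm \<Rightarrow> _)"
    by (rule linearI) (auto simp: conj_transpose_add conj_transpose_scaleR)
  have "conj_transpose (S k)
      = conj_transpose (grid_avg N (\<lambda>\<theta>. cscale (exp (\<i> * of_real (freq_pairing k \<theta>))) (\<Phi> \<theta>)))"
    using assms by (simp add: feasible_def)
  also have "\<dots> = grid_avg N (\<lambda>\<theta>. cscale (exp (\<i> * of_real (freq_pairing (- k) \<theta>))) (\<Phi> \<theta>))"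
    unfolding grid_avg_linear[OF lin]
    using assms(1)
    by (intro grid_avg_cong)
      (auto simp: conj_transpose_cscale exp_cnj freq_pairing_minus feasible_def pos_def_def hermitian_def)
  also have "\<dots> = S (- k)"
    using assms by (simp add: feasible_def)
  finally show ?thesis by simp
qed

text \<open>Writing each \<open>S k\<close> as a moment of \<Phi>, the conjugate transpose changes
  the character to \<open>exp (- \<i> * \<dots>)\<close>, which is the one in
  \<open>trig_poly\<close>.\<close>

lemma family_inner_feasible:
  fixes Q :: "int ^ 'd \<Rightarrow> complex ^ 'm ^ 'm"
  assumes "feasible \<Lambda> N S \<Phi>"
  shows "family_inner \<Lambda> Q S = grid_avg N (\<lambda>\<theta>. trace (trig_poly \<Lambda> Q \<theta> ** \<Phi> \<theta>))"
proof -
  have lin: "linear (\<lambda>X. trace (Q k ** conj_transpose X))" for k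
    by (rule linearI)
      (auto simp: conj_transpose_add conj_transpose_scaleR matrix_add_ldistrib trace_add
        matrix_mult_scaleR_right trace_scaleR)
  have "family_inner \<Lambda> Q S = (\<Sum>k\<in>\<Lambda>. trace (Q k ** conj_transpose
      (grid_avg N (\<lambda>\<theta>. cscale (exp (\<i> * of_real (freq_pairing k \<theta>))) (\<Phi> \<theta>)))))"
    using assms by (simp add: family_inner_def feasible_def)
  also have "\<dots> = grid_avg N (\<lambda>\<theta>. \<Sum>k\<in>\<Lambda>. trace (Q k ** conj_transpose
      (cscale (exp (\<i> * of_real (freq_pairing k \<theta>))) (\<Phi> \<theta>))))"
    unfolding grid_avg_sum by (simp only: grid_avg_linear[OF lin])
  also have "\<dots> = grid_avg N (\<lambda>\<theta>. trace (trig_poly \<Lambda> Q \<theta> ** \<Phi> \<theta>))"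
    using assms
    by (intro grid_avg_cong)
      (auto simp: trig_poly_def matrix_sum_mult_left trace_sum cscale_mult_left cscale_mult_right
        trace_cscale conj_transpose_cscale exp_cnj feasible_def pos_def_def hermitian_def)
  finally show ?thesis .
qed

section \<open>Duality\<close>

lemma trace_mult_conj_transpose_self:
  fixes X :: "complex ^ 'n ^ 'n"
  shows "Re (trace (X ** conj_transpose X)) = (norm X)\<^sup>2"
proof -
  have "(norm X)\<^sup>2 = (\<Sum>i\<in>UNIV. \<Sum>j\<in>UNIV. (cmod (X $ i $ j))\<^sup>2)"
    by (simp add: norm_vec_def L2_set_def sum_nonneg)
  then show ?thesis
    by (simp add: trace_def matrix_matrix_mult_def cmod_power2) (simp add: power2_eq_square)
qed

lemma tendsto_trace_mult:
  fixes f :: "'a \<Rightarrow> complex ^ 'n ^ 'n"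
  assumes "(f \<longlongrightarrow> X) F"
  shows "((\<lambda>x. Re (trace (f x ** B))) \<longlongrightarrow> Re (trace (X ** B))) F"
  unfolding trace_def matrix_matrix_mult_def vec_lambda_beta
  by (rule tendsto_Re, rule tendsto_sum, rule tendsto_sum, rule tendsto_mult,
      rule tendsto_vec_nth, rule tendsto_vec_nth, rule assms, rule tendsto_const)

lemma tendsto_grid_avg:
  fixes f :: "'a \<Rightarrow> real ^ 'd \<Rightarrow> 'b::real_normed_vector"
  assumes "\<And>\<theta>. \<theta> \<in> torus_grid N \<Longrightarrow> ((\<lambda>t. f t \<theta>) \<longlongrightarrow> g \<theta>) F"
  shows "((\<lambda>t. grid_avg N (f t)) \<longlongrightarrow> grid_avg N g) F"
  unfolding grid_avg_def using assms
  by (intro tendsto_scaleR tendsto_const tendsto_sum) (auto simp: torus_grid_def)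

lemma continuous_on_cscale:
  assumes "continuous_on S f"
  shows "continuous_on S (\<lambda>x. cscale c (f x))"
  unfolding cscale_def
  by (rule continuous_on_vec_lambda, rule continuous_on_vec_lambda, rule continuous_on_mult,
      rule continuous_on_const, rule continuous_on_component, rule continuous_on_component, rule assms)

lemma continuous_on_conj_transpose:
  assumes "continuous_on S f"
  shows "continuous_on S (\<lambda>x. conj_transpose (f x))"
  unfolding conj_transpose_def
  by (rule continuous_on_vec_lambda, rule continuous_on_vec_lambda, rule continuous_on_cnj,
      rule continuous_on_component, rule continuous_on_component, rule assms)

lemma continuous_on_quad_form_matrix:
  fixes f :: "'a::topological_space \<Rightarrow> complex ^ 'n ^ 'n"
  assumes "continuous_on S f"
  shows "continuous_on S (\<lambda>y. quad_form (f y) x)"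
  unfolding quad_form_def matrix_vector_mult_def vec_lambda_beta
  by (rule continuous_on_Re, rule continuous_on_sum, rule continuous_on_mult,
      rule continuous_on_const, rule continuous_on_sum, rule continuous_on_mult,
      rule continuous_on_component, rule continuous_on_component, rule assms, rule continuous_on_const)

lemma continuous_on_trace_mult:
  fixes f :: "'a::topological_space \<Rightarrow> complex ^ 'n ^ 'n"
  assumes "continuous_on S f"
  shows "continuous_on S (\<lambda>y. trace (f y ** B))"
  unfolding trace_def matrix_matrix_mult_def vec_lambda_beta
  by (rule continuous_on_sum, rule continuous_on_sum, rule continuous_on_mult,
      rule continuous_on_component, rule continuous_on_component, rule assms, rule continuous_on_const)

lemma continuous_on_grid_avg:
  fixes f :: "'a::topological_space \<Rightarrow> real ^ 'd \<Rightarrow> 'b::real_normed_vector"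
  assumes "\<And>\<theta>. \<theta> \<in> torus_grid N \<Longrightarrow> continuous_on S (\<lambda>x. f x \<theta>)"
  shows "continuous_on S (\<lambda>x. grid_avg N (f x))"
  unfolding grid_avg_def using assms
  by (intro continuous_on_scaleR continuous_on_const continuous_on_sum) (auto simp: torus_grid_def)

text \<open>Tychonoff's theorem. Multiplier families are functions on the infinite type
  \<open>int ^ 'd\<close>, so compactness is taken in the product topology.\<close>

lemma compact_PiE_UNIV:
  fixes K :: "'i \<Rightarrow> 'a::topological_space set"
  assumes "\<And>i. compact (K i)"
  shows "compact (PiE UNIV K)"
  using assms compactin_PiE[of "\<lambda>_. euclidean" UNIV K] by (simp add: euclidean_product_topology)

section \<open>The dual function, the gap and stationarity\<close>

locale moment_problem =
  fixes \<Lambda> :: "(int ^ 'd) set"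
    and N :: "nat ^ 'd"
    and \<Psi> :: "real ^ 'd \<Rightarrow> complex ^ 'm ^ 'm"
    and S :: "int ^ 'd \<Rightarrow> complex ^ 'm ^ 'm"
  assumes finite_freqs: "finite \<Lambda>"
    and uminus_freqs: "\<And>k. k \<in> \<Lambda> \<Longrightarrow> - k \<in> \<Lambda>"
    and N_pos: "\<And>j. N $ j > 0"
    and N_large: "\<And>j. int (N $ j) > 2 * max_index \<Lambda> j"
    and prior: "\<And>\<theta>. \<theta> \<in> torus_grid N \<Longrightarrow> pos_def (\<Psi> \<theta>)"
    and feasible_ex: "\<exists>\<Phi>. feasible \<Lambda> N S \<Phi>"
begin

definition inv_spectrum :: "(int ^ 'd \<Rightarrow> complex ^ 'm ^ 'm) \<Rightarrow> real ^ 'd \<Rightarrow> complex ^ 'm ^ 'm" where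
  "inv_spectrum Q \<theta> = matrix_inv (\<Psi> \<theta>) + trig_poly \<Lambda> Q \<theta>"

abbreviation "J \<equiv> dual_fun \<Lambda> N \<Psi> S"

abbreviation "L \<equiv> L_plus \<Lambda> N \<Psi>"

lemma mem_L: "Q \<in> L \<longleftrightarrow> Q \<in> multipliers \<Lambda> \<and> (\<forall>\<theta>\<in>torus_grid N. pos_def (inv_spectrum Q \<theta>))"
  by (simp add: L_plus_def inv_spectrum_def)

lemma Re_grid_avg: "Re (grid_avg N f) = grid_avg N (\<lambda>\<theta>. Re (f \<theta>))"
  by (rule grid_avg_linear) (auto intro: linearI)

text \<open>Any feasible \<Phi> represents the linear term, and \<open>Q\<close> is replaced by
  \<open>inv_spectrum Q\<close> minus the inverse prior. The second average is independent of
  \<open>Q\<close>, so estimates can be made pointwise in \<open>inv_spectrum Q\<close>.\<close>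

lemma dual_fun_eq:
  assumes "feasible \<Lambda> N S \<Phi>"
  shows "J Q = grid_avg N (\<lambda>\<theta>. Re (trace (inv_spectrum Q \<theta> ** \<Phi> \<theta>)) - log_det (inv_spectrum Q \<theta>))
     - grid_avg N (\<lambda>\<theta>. Re (trace (matrix_inv (\<Psi> \<theta>) ** \<Phi> \<theta>)))"
proof -
  have "trace (trig_poly \<Lambda> Q \<theta> ** \<Phi> \<theta>)
      = trace (inv_spectrum Q \<theta> ** \<Phi> \<theta>) - trace (matrix_inv (\<Psi> \<theta>) ** \<Phi> \<theta>)" for \<theta>
    by (simp add: inv_spectrum_def trace_mul_sym[of _ "\<Phi> \<theta>"] matrix_add_ldistrib trace_add)
  then show ?thesis
    by (simp add: dual_fun_def family_inner_feasible[OF assms] Re_grid_avg grid_avg_diff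
        flip: inv_spectrum_def)
qed

text \<open>Stein's loss between \<Phi> and the inverse of \<open>inv_spectrum Q\<close>: twice the
  relative entropy of the centred real Gaussian laws in the case of real matrices.\<close>

definition gap :: "(real ^ 'd \<Rightarrow> complex ^ 'm ^ 'm) \<Rightarrow> (int ^ 'd \<Rightarrow> complex ^ 'm ^ 'm) \<Rightarrow> real ^ 'd \<Rightarrow> real" where
  "gap \<Phi> Q \<theta> = Re (trace (inv_spectrum Q \<theta> ** \<Phi> \<theta>)) - log_det (inv_spectrum Q \<theta>)
      - log_det (\<Phi> \<theta>) - CARD('m)"

text \<open>Weak duality with an explicit remainder: the traces of
  \<open>\<Psi>\<^sup>-\<^sup>1 \<Phi>\<close> cancel, leaving a constant of the prior and the
  gap.\<close>

lemma divergence_plus_dual_fun: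
  assumes "feasible \<Lambda> N S \<Phi>"
  shows "divergence N \<Phi> \<Psi> + J Q = grid_avg N (\<lambda>\<theta>. log_det (\<Psi> \<theta>)) + grid_avg N (gap \<Phi> Q)"
proof -
  have "divergence N \<Phi> \<Psi> = grid_avg N (\<lambda>\<theta>. log_det (\<Psi> \<theta>) - log_det (\<Phi> \<theta>)
      + Re (trace (matrix_inv (\<Psi> \<theta>) ** \<Phi> \<theta>)) - CARD('m))"
    unfolding divergence_def
  proof (rule grid_avg_cong)
    fix \<theta> assume \<theta>: "\<theta> \<in> torus_grid N"
    then have pd: "pos_def (\<Phi> \<theta>)" "pos_def (\<Psi> \<theta>)"
      using assms prior by (auto simp: feasible_def)
    show "log_det (matrix_inv (\<Phi> \<theta>) ** \<Psi> \<theta>) + Re (trace (matrix_inv (\<Psi> \<theta>) ** (\<Phi> \<theta> - \<Psi> \<theta>)))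
      = log_det (\<Psi> \<theta>) - log_det (\<Phi> \<theta>) + Re (trace (matrix_inv (\<Psi> \<theta>) ** \<Phi> \<theta>)) - CARD('m)"
      by (simp add: log_det_mult pos_def_matrix_inv log_det_matrix_inv pd matrix_diff_ldistrib
          trace_sub matrix_inv_mult pos_def_invertible trace_I)
  qed
  then show ?thesis
    unfolding dual_fun_eq[OF assms] gap_def
    by (simp add: grid_avg_diff grid_avg_add)
qed

lemma gap_nonneg: "pos_def (inv_spectrum Q \<theta>) \<Longrightarrow> pos_def (\<Phi> \<theta>) \<Longrightarrow> gap \<Phi> Q \<theta> \<ge> 0"
  using trace_mult_minus_log_dets(1)[of "inv_spectrum Q \<theta>" "\<Phi> \<theta>"] by (simp add: gap_def)

lemma gap_eq_0:
  "pos_def (inv_spectrum Q \<theta>) \<Longrightarrow> pos_def (\<Phi> \<theta>) \<Longrightarrow> gap \<Phi> Q \<theta> = 0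
    \<Longrightarrow> inv_spectrum Q \<theta> ** \<Phi> \<theta> = mat 1"
  using trace_mult_minus_log_dets(2)[of "inv_spectrum Q \<theta>" "\<Phi> \<theta>"] by (simp add: gap_def)

lemma gap_inverse:
  assumes "pos_def (inv_spectrum Q \<theta>)"
  shows "gap (\<lambda>\<theta>. matrix_inv (inv_spectrum Q \<theta>)) Q \<theta> = 0"
  using assms
  by (simp add: gap_def matrix_inv_mult pos_def_invertible trace_I log_det_matrix_inv)

lemma inv_spectrum_eqD:
  assumes "Q \<in> L" "Q' \<in> L" "\<And>\<theta>. \<theta> \<in> torus_grid N \<Longrightarrow> inv_spectrum Q \<theta> = inv_spectrum Q' \<theta>"
  shows "Q = Q'"
proof -
  have "Q k = Q' k" if "k \<in> \<Lambda>" for k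
  proof -
    have "Q k = grid_avg N (\<lambda>\<theta>. cscale (exp (\<i> * of_real (freq_pairing k \<theta>))) (trig_poly \<Lambda> Q \<theta>))"
      using fourier_inversion[OF finite_freqs N_pos N_large that] by metis
    also have "\<dots> = grid_avg N (\<lambda>\<theta>. cscale (exp (\<i> * of_real (freq_pairing k \<theta>))) (trig_poly \<Lambda> Q' \<theta>))"
      using assms(3) by (intro grid_avg_cong) (simp add: inv_spectrum_def)
    also have "\<dots> = Q' k"
      using fourier_inversion[OF finite_freqs N_pos N_large that] by metis
    finally show ?thesis .
  qed
  then show ?thesis
    using assms(1,2) by (intro extensionalityI[of _ \<Lambda>]) (auto simp: L_plus_def multipliers_def)
qed

text \<open>Moving along the moment defect \<delta>, the one-sided slope of the dual function at the
  minimizer is minus the squared norm of \<delta>. Minimality makes it nonnegative, so \<delta>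
  vanishes.\<close>

lemma dual_minimizer_feasible:
  assumes "Q \<in> L" and minimal: "\<And>Q'. Q' \<in> L \<Longrightarrow> J Q \<le> J Q'"
  shows "feasible \<Lambda> N S (\<lambda>\<theta>. matrix_inv (inv_spectrum Q \<theta>))"
proof -
  obtain \<Phi>0 where \<Phi>0: "feasible \<Lambda> N S \<Phi>0" using feasible_ex by blast
  have pd: "pos_def (inv_spectrum Q \<theta>)" if "\<theta> \<in> torus_grid N" for \<theta>
    using assms(1) that by (simp add: mem_L)
  define R where "R k = grid_avg N (\<lambda>\<theta>. cscale (exp (\<i> * of_real (freq_pairing k \<theta>)))
      (matrix_inv (inv_spectrum Q \<theta>)))" for k
  have R: "feasible \<Lambda> N R (\<lambda>\<theta>. matrix_inv (inv_spectrum Q \<theta>))"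
    using pd by (simp add: feasible_def R_def pos_def_matrix_inv)
  \<comment> \<open>\<open>R\<close> holds the moments of the candidate, so \<delta> is what
    separates it from feasibility. Both families come from feasible functions, which makes \<delta>
    a multiplier; \<open>restrict\<close> makes it extensional.\<close>
  define \<delta> where "\<delta> = restrict (\<lambda>k. R k - S k) \<Lambda>"
  define B where "B = trig_poly \<Lambda> \<delta>"
  have \<delta>: "\<delta> \<in> multipliers \<Lambda>"
    using feasible_uminus[OF R] feasible_uminus[OF \<Phi>0]
    by (auto simp: multipliers_def \<delta>_def uminus_freqs conj_transpose_diff)
  have B: "hermitian (B \<theta>)" for \<theta>
    unfolding B_def by (intro hermitian_trig_poly finite_freqs uminus_freqs \<delta>)
  define Qt where "Qt t = restrict (\<lambda>k. Q k + t *\<^sub>R \<delta> k) \<Lambda>" for t :: real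
  have Qt_mult: "Qt t \<in> multipliers \<Lambda>" for t
    using \<delta> assms(1)
    by (auto simp: mem_L multipliers_def Qt_def uminus_freqs conj_transpose_add conj_transpose_scaleR)
  have Qt_spec: "inv_spectrum (Qt t) \<theta> = inv_spectrum Q \<theta> + t *\<^sub>R B \<theta>" for t \<theta>
    by (simp add: inv_spectrum_def trig_poly_def Qt_def B_def vec_eq_iff scaleR_sum_right
        distrib_left sum.distrib)
  have Qt_inner: "family_inner \<Lambda> (Qt t) S = family_inner \<Lambda> Q S + t *\<^sub>R family_inner \<Lambda> \<delta> S" for t
  proof -
    have "trace ((X + t *\<^sub>R Y) ** Z) = trace (X ** Z) + t *\<^sub>R trace (Y ** Z)"
      for X Y Z :: "complex ^ 'm ^ 'm"
      by (simp add: trace_mul_sym[of _ Z] matrix_add_ldistrib trace_add matrix_mult_scaleR_right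
          trace_scaleR)
    then show ?thesis
      by (simp add: family_inner_def Qt_def sum.distrib scaleR_sum_right)
  qed
  have ev: "eventually (\<lambda>t. Qt t \<in> L) (at_right 0)"
  proof -
    have "eventually (\<lambda>t. \<forall>\<theta>\<in>torus_grid N. pos_def (inv_spectrum Q \<theta> + t *\<^sub>R B \<theta>)) (at_right 0)"
      using pd B finite_torus_grid
      by (intro eventually_ball_finite) (auto intro!: eventually_pos_def_perturbation)
    then show ?thesis by (simp add: mem_L Qt_mult Qt_spec)
  qed
  \<comment> \<open>An upper bound for the difference quotient of \<open>J\<close> along
    \<open>Qt\<close>. The supergradient is taken at the moved point and only then is
    \<open>t\<close> sent to 0, so log det need not be differentiated.\<close>
  let ?D = "\<lambda>t. Re (family_inner \<Lambda> \<delta> S)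
      - grid_avg N (\<lambda>\<theta>. Re (trace (matrix_inv (inv_spectrum Q \<theta> + t *\<^sub>R B \<theta>) ** B \<theta>)))"
  have "eventually (\<lambda>t. ?D t \<ge> 0) (at_right 0)"
    using ev eventually_at_right_less[of "0::real"]
  proof eventually_elim
    case (elim t)
    have "t * grid_avg N (\<lambda>\<theta>. Re (trace (matrix_inv (inv_spectrum Q \<theta> + t *\<^sub>R B \<theta>) ** B \<theta>)))
      = grid_avg N (\<lambda>\<theta>. t * Re (trace (matrix_inv (inv_spectrum Q \<theta> + t *\<^sub>R B \<theta>) ** B \<theta>)))"
      by (simp add: grid_avg_def sum_distrib_left)
    also have "\<dots> \<le> grid_avg N (\<lambda>\<theta>. log_det (inv_spectrum (Qt t) \<theta>) - log_det (inv_spectrum Q \<theta>))"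
    proof (rule grid_avg_mono)
      fix \<theta> assume \<theta>: "\<theta> \<in> torus_grid N"
      then have "pos_def (inv_spectrum Q \<theta> + t *\<^sub>R B \<theta>)"
        using elim(1) by (simp add: mem_L Qt_spec)
      from log_det_supergradient[OF pd[OF \<theta>] this]
      have "log_det (inv_spectrum Q \<theta>) - log_det (inv_spectrum Q \<theta> + t *\<^sub>R B \<theta>)
        \<le> Re (trace (matrix_inv (inv_spectrum Q \<theta> + t *\<^sub>R B \<theta>) ** ((- t) *\<^sub>R B \<theta>)))"
        by simp
      then show "t * Re (trace (matrix_inv (inv_spectrum Q \<theta> + t *\<^sub>R B \<theta>) ** B \<theta>))
        \<le> log_det (inv_spectrum (Qt t) \<theta>) - log_det (inv_spectrum Q \<theta>)"
        unfolding matrix_mult_scaleR_right trace_scaleR Qt_spec by simp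
    qed
    also have "\<dots> = t * Re (family_inner \<Lambda> \<delta> S) - (J (Qt t) - J Q)"
      by (simp add: dual_fun_def Qt_inner grid_avg_diff flip: inv_spectrum_def)
    also have "\<dots> \<le> t * Re (family_inner \<Lambda> \<delta> S)"
      using minimal[OF elim(1)] by simp
    finally show ?case
      using elim(2) by simp
  qed
  moreover have "((\<lambda>t. ?D t) \<longlongrightarrow> Re (family_inner \<Lambda> \<delta> S)
      - grid_avg N (\<lambda>\<theta>. Re (trace (matrix_inv (inv_spectrum Q \<theta>) ** B \<theta>)))) (at_right 0)"
  proof (intro tendsto_diff tendsto_const tendsto_grid_avg tendsto_trace_mult tendsto_matrix_inv)
    fix \<theta> assume \<theta>: "\<theta> \<in> torus_grid N"
    have "((\<lambda>t. inv_spectrum Q \<theta> + t *\<^sub>R B \<theta>) \<longlongrightarrow> inv_spectrum Q \<theta> + 0 *\<^sub>R B \<theta>) (at_right 0)"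
      by (intro tendsto_intros)
    then show "((\<lambda>t. inv_spectrum Q \<theta> + t *\<^sub>R B \<theta>) \<longlongrightarrow> inv_spectrum Q \<theta>) (at_right 0)"
      by simp
    show "det (inv_spectrum Q \<theta>) \<noteq> 0"
      using pos_def_invertible[OF pd[OF \<theta>]] by (simp add: invertible_det_nz)
  qed
  ultimately have "0 \<le> Re (family_inner \<Lambda> \<delta> S)
      - grid_avg N (\<lambda>\<theta>. Re (trace (matrix_inv (inv_spectrum Q \<theta>) ** B \<theta>)))"
    by (intro tendsto_lowerbound[of ?D]) auto
  \<comment> \<open>The candidate is feasible for its own moments \<open>R\<close>, so the limit
    becomes the pairing of \<delta> with \<open>S - R\<close>, that is, with minus \<delta>.\<close>
  also have "grid_avg N (\<lambda>\<theta>. Re (trace (matrix_inv (inv_spectrum Q \<theta>) ** B \<theta>)))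
      = Re (family_inner \<Lambda> \<delta> R)"
    unfolding family_inner_feasible[OF R] Re_grid_avg B_def
    by (subst trace_mul_sym) (rule refl)
  also have "Re (family_inner \<Lambda> \<delta> S) - Re (family_inner \<Lambda> \<delta> R)
      = - (\<Sum>k\<in>\<Lambda>. Re (trace (\<delta> k ** conj_transpose (\<delta> k))))"
    by (simp add: family_inner_def \<delta>_def conj_transpose_diff matrix_diff_ldistrib trace_sub
        flip: sum_subtractf sum_negf)
  finally have "(\<Sum>k\<in>\<Lambda>. (norm (\<delta> k))\<^sup>2) \<le> 0"
    by (simp add: trace_mult_conj_transpose_self)
  then have "\<forall>k\<in>\<Lambda>. (norm (\<delta> k))\<^sup>2 = 0"
    using sum_nonneg_eq_0_iff[OF finite_freqs, of "\<lambda>k. (norm (\<delta> k))\<^sup>2"]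
    by (simp add: order_antisym sum_nonneg)
  then have "\<forall>k\<in>\<Lambda>. R k = S k"
    by (auto simp: \<delta>_def)
  then show ?thesis
    using R by (simp add: feasible_def)
qed

section \<open>Existence of a dual minimizer\<close>

lemma continuous_on_inv_spectrum: "continuous_on UNIV (\<lambda>Q. inv_spectrum Q \<theta>)"
  unfolding inv_spectrum_def trig_poly_def
  by (intro continuous_on_add continuous_on_const continuous_on_sum continuous_on_cscale
      continuous_on_product_coordinates)

lemma continuous_on_dual_fun:
  assumes "\<And>Q \<theta>. Q \<in> K \<Longrightarrow> \<theta> \<in> torus_grid N \<Longrightarrow> Re (det (inv_spectrum Q \<theta>)) > 0"
  shows "continuous_on K J"
proof -
  have "continuous_on K (\<lambda>Q. log_det (inv_spectrum Q \<theta>))" if "\<theta> \<in> torus_grid N" for \<theta>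
    unfolding log_det_def using assms that
    by (intro continuous_on_ln continuous_on_Re continuous_on_det
        continuous_on_subset[OF continuous_on_inv_spectrum]) force+
  moreover have "continuous_on K (\<lambda>Q. Q k)" for k
    by (rule continuous_on_subset[OF continuous_on_product_coordinates]) simp
  ultimately show ?thesis
    unfolding dual_fun_def family_inner_def inv_spectrum_def[symmetric]
    by (intro continuous_on_diff continuous_on_Re continuous_on_sum continuous_on_trace_mult
        continuous_on_grid_avg)
qed

text \<open>The bound on \<open>J\<close> controls only an average. Coercivity makes each summand
  \<open>g Q \<theta> - b \<theta>\<close> nonnegative, so every one is bounded separately; trace
  and determinant bounds follow at each grid point.\<close>

lemma dual_sublevel_bounds:
  obtains M m where
    "\<And>Q \<theta>. Q \<in> L \<Longrightarrow> J Q \<le> C \<Longrightarrow> \<theta> \<in> torus_grid N \<Longrightarrow> Re (trace (inv_spectrum Q \<theta>)) \<le> M \<theta>"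
    "\<And>Q \<theta>. Q \<in> L \<Longrightarrow> J Q \<le> C \<Longrightarrow> \<theta> \<in> torus_grid N \<Longrightarrow> Re (det (inv_spectrum Q \<theta>)) \<ge> m \<theta>"
    "\<And>\<theta>. m \<theta> > 0"
proof -
  obtain \<Phi> where \<Phi>: "feasible \<Lambda> N S \<Phi>" using feasible_ex by blast
  have pd: "pos_def (\<Phi> \<theta>)" if "\<theta> \<in> torus_grid N" for \<theta>
    using \<Phi> that by (simp add: feasible_def)
  have "\<exists>\<epsilon> b. \<epsilon> > 0 \<and> (\<forall>A. pos_def A \<longrightarrow> Re (trace (A ** \<Phi> \<theta>)) - log_det A \<ge> b + \<epsilon> * Re (trace A))"
    if "\<theta> \<in> torus_grid N" for \<theta>
    using trace_minus_log_det_coercive[OF pd[OF that]] by metis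
  then obtain \<epsilon> b where \<epsilon>: "\<And>\<theta>. \<theta> \<in> torus_grid N \<Longrightarrow> \<epsilon> \<theta> > 0"
    and b: "\<And>\<theta> A. \<theta> \<in> torus_grid N \<Longrightarrow> pos_def A
        \<Longrightarrow> Re (trace (A ** \<Phi> \<theta>)) - log_det A \<ge> b \<theta> + \<epsilon> \<theta> * Re (trace A)"
    by metis
  define g where "g Q \<theta> = Re (trace (inv_spectrum Q \<theta> ** \<Phi> \<theta>)) - log_det (inv_spectrum Q \<theta>)" for Q \<theta>
  \<comment> \<open>The bound \<open>C\<close> with the term dropped by \<open>dual_fun_eq\<close>
    restored and the average of \<open>b\<close> removed, times the number of grid points from
    \<open>grid_avg_member_le\<close>.\<close>
  define c where "c = real (\<Prod>j\<in>UNIV. N $ j)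
      * (C + grid_avg N (\<lambda>\<theta>. Re (trace (matrix_inv (\<Psi> \<theta>) ** \<Phi> \<theta>))) - grid_avg N b)"
  have bound: "g Q \<theta> - b \<theta> \<le> c" if "Q \<in> L" "J Q \<le> C" "\<theta> \<in> torus_grid N" for Q \<theta>
  proof -
    have "g Q \<theta> - b \<theta> \<ge> 0" if "\<theta> \<in> torus_grid N" for \<theta>
    proof -
      have pdQ: "pos_def (inv_spectrum Q \<theta>)" using \<open>Q \<in> L\<close> that by (simp add: mem_L)
      have "0 \<le> \<epsilon> \<theta> * Re (trace (inv_spectrum Q \<theta>))"
        using \<epsilon>[OF that] trace_pos[OF pdQ] by simp
      then show ?thesis using b[OF that pdQ] by (simp add: g_def)
    qed
    from grid_avg_member_le[OF this N_pos that(3)]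
    have "g Q \<theta> - b \<theta> \<le> real (\<Prod>j\<in>UNIV. N $ j) * grid_avg N (\<lambda>\<theta>. g Q \<theta> - b \<theta>)" .
    also have "\<dots> \<le> c"
      unfolding c_def using that(2)
      by (intro mult_left_mono) (simp_all add: dual_fun_eq[OF \<Phi>] grid_avg_diff prod_nonneg flip: g_def)
    finally show ?thesis .
  qed
  show thesis
  proof
    fix Q \<theta> assume *: "Q \<in> L" "J Q \<le> C" "\<theta> \<in> torus_grid N"
    then have pdQ: "pos_def (inv_spectrum Q \<theta>)" by (simp add: mem_L)
    have "\<epsilon> \<theta> * Re (trace (inv_spectrum Q \<theta>)) \<le> c"
      using bound[OF *] b[OF *(3) pdQ] by (simp add: g_def)
    then show "Re (trace (inv_spectrum Q \<theta>)) \<le> c / \<epsilon> \<theta>"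
      using \<epsilon>[OF *(3)] by (simp add: field_simps)
    \<comment> \<open>Dropping the positive trace from \<open>g\<close> leaves a bound on minus log
      det alone.\<close>
    have "- (c + b \<theta>) \<le> ln (Re (det (inv_spectrum Q \<theta>)))"
      using bound[OF *] trace_mult_pos[OF pdQ pd[OF *(3)]] by (simp add: g_def log_det_def)
    then show "exp (- (c + b \<theta>)) \<le> Re (det (inv_spectrum Q \<theta>))"
      using pos_def_det(1)[OF pdQ] by (simp add: ln_ge_iff)
  qed simp
qed

text \<open>Fourier inversion with characters of modulus 1: the grid values control every
  coefficient.\<close>

lemma norm_le_inv_spectrum:
  assumes "k \<in> \<Lambda>"
  shows "norm (Q k) \<le> grid_avg N (\<lambda>\<theta>. norm (inv_spectrum Q \<theta>) + norm (matrix_inv (\<Psi> \<theta>)))"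
proof -
  have "norm (Q k) = norm (grid_avg N (\<lambda>\<theta>. cscale (exp (\<i> * of_real (freq_pairing k \<theta>))) (trig_poly \<Lambda> Q \<theta>)))"
    using fourier_inversion[OF finite_freqs N_pos N_large assms] by metis
  also have "\<dots> \<le> grid_avg N (\<lambda>\<theta>. norm (trig_poly \<Lambda> Q \<theta>))"
    by (rule order_trans[OF norm_grid_avg_le]) (simp add: norm_cscale)
  also have "\<dots> \<le> grid_avg N (\<lambda>\<theta>. norm (inv_spectrum Q \<theta>) + norm (matrix_inv (\<Psi> \<theta>)))"
  proof (rule grid_avg_mono)
    fix \<theta>
    have "trig_poly \<Lambda> Q \<theta> = inv_spectrum Q \<theta> - matrix_inv (\<Psi> \<theta>)"
      by (simp add: inv_spectrum_def)
    then show "norm (trig_poly \<Lambda> Q \<theta>) \<le> norm (inv_spectrum Q \<theta>) + norm (matrix_inv (\<Psi> \<theta>))"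
      by (metis norm_triangle_ineq4)
  qed
  finally show ?thesis .
qed

text \<open>Positive definiteness is not a closed condition. The compact set \<open>K\<close> uses
  semidefiniteness with a positive lower bound on the determinant instead, which restores
  definiteness; thus \<open>K\<close> lies in \<open>L\<close> and contains the sublevel set of
  \<open>Q0\<close>.\<close>

lemma dual_minimizer_exists: "\<exists>Q\<in>L. \<forall>Q'\<in>L. J Q \<le> J Q'"
proof -
  define Q0 :: "int ^ 'd \<Rightarrow> complex ^ 'm ^ 'm" where "Q0 = restrict (\<lambda>_. 0) \<Lambda>"
  have "trig_poly \<Lambda> Q0 \<theta> = 0" for \<theta>
    by (simp add: trig_poly_def Q0_def vec_eq_iff)
  moreover have "Q0 \<in> multipliers \<Lambda>"
    using uminus_freqs by (auto simp: multipliers_def Q0_def vec_eq_iff)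
  ultimately have Q0: "Q0 \<in> L"
    using prior by (simp add: L_plus_def pos_def_matrix_inv)
  obtain M m where M: "\<And>Q \<theta>. Q \<in> L \<Longrightarrow> J Q \<le> J Q0 \<Longrightarrow> \<theta> \<in> torus_grid N
      \<Longrightarrow> Re (trace (inv_spectrum Q \<theta>)) \<le> M \<theta>"
    and m: "\<And>Q \<theta>. Q \<in> L \<Longrightarrow> J Q \<le> J Q0 \<Longrightarrow> \<theta> \<in> torus_grid N
      \<Longrightarrow> Re (det (inv_spectrum Q \<theta>)) \<ge> m \<theta>" "\<And>\<theta>. m \<theta> > 0"
    using dual_sublevel_bounds[of "J Q0"] by blast
  define r where "r = grid_avg N (\<lambda>\<theta>. (real CARD('m))\<^sup>2 * M \<theta> + norm (matrix_inv (\<Psi> \<theta>)))"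
  \<comment> \<open>The factor \<open>{undefined}\<close> encodes extensionality, and the ball of
    radius \<open>r\<close> comes from \<open>norm_le_inv_spectrum\<close> and the trace bound
    \<open>M\<close>.\<close>
  define K where "K = PiE UNIV (\<lambda>k. if k \<in> \<Lambda> then cball 0 r else {undefined})
    \<inter> (\<Inter>k\<in>\<Lambda>. {Q. Q (- k) = conj_transpose (Q k)})
    \<inter> (\<Inter>\<theta>\<in>torus_grid N. \<Inter>x. {Q. quad_form (inv_spectrum Q \<theta>) x \<ge> 0})
    \<inter> (\<Inter>\<theta>\<in>torus_grid N. {Q. Re (det (inv_spectrum Q \<theta>)) \<ge> m \<theta>})"
  have "closed {Q :: int ^ 'd \<Rightarrow> complex ^ 'm ^ 'm. Q (- k) = conj_transpose (Q k)}" for k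
    by (rule closed_Collect_eq, rule continuous_on_product_coordinates,
        rule continuous_on_conj_transpose, rule continuous_on_product_coordinates)
  moreover have "closed {Q. quad_form (inv_spectrum Q \<theta>) x \<ge> 0}" for \<theta> x
    by (rule closed_Collect_le, rule continuous_on_const, rule continuous_on_quad_form_matrix,
        rule continuous_on_inv_spectrum)
  moreover have "closed {Q. Re (det (inv_spectrum Q \<theta>)) \<ge> m \<theta>}" for \<theta>
    by (rule closed_Collect_le, rule continuous_on_const, rule continuous_on_Re,
        rule continuous_on_det, rule continuous_on_inv_spectrum)
  moreover have "compact (PiE UNIV (\<lambda>k. if k \<in> \<Lambda> then cball (0 :: complex ^ 'm ^ 'm) r else {undefined}))"
    by (rule compact_PiE_UNIV) simp
  ultimately have "compact K"
    unfolding K_def by (intro compact_Int_closed closed_INT ballI)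
  have sub: "Q \<in> K" if Q: "Q \<in> L" "J Q \<le> J Q0" for Q
  proof -
    have pd: "pos_def (inv_spectrum Q \<theta>)" if "\<theta> \<in> torus_grid N" for \<theta>
      using Q that by (simp add: mem_L)
    have "norm (Q k) \<le> r" if "k \<in> \<Lambda>" for k
    proof (rule order_trans[OF norm_le_inv_spectrum[OF that]])
      show "grid_avg N (\<lambda>\<theta>. norm (inv_spectrum Q \<theta>) + norm (matrix_inv (\<Psi> \<theta>))) \<le> r"
        unfolding r_def
      proof (intro grid_avg_mono add_right_mono)
        fix \<theta> assume \<theta>: "\<theta> \<in> torus_grid N"
        have "norm (inv_spectrum Q \<theta>) \<le> (real CARD('m))\<^sup>2 * Re (trace (inv_spectrum Q \<theta>))"
          by (rule pos_def_norm_le_trace[OF pd[OF \<theta>]])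
        also have "\<dots> \<le> (real CARD('m))\<^sup>2 * M \<theta>"
          using M[OF Q \<theta>] by (intro mult_left_mono) auto
        finally show "norm (inv_spectrum Q \<theta>) \<le> (real CARD('m))\<^sup>2 * M \<theta>" .
      qed
    qed
    moreover have "quad_form (inv_spectrum Q \<theta>) x \<ge> 0" if "\<theta> \<in> torus_grid N" for \<theta> x
      using pd[OF that] by (cases "x = 0") (auto simp: pos_def_quad_form less_imp_le quad_form_def)
    ultimately show ?thesis
      using Q m(1)[OF Q] by (auto simp: K_def PiE_iff mem_L multipliers_def extensional_def)
  qed
  have KL: "Q \<in> L" if "Q \<in> K" for Q
  proof -
    have mult: "Q \<in> multipliers \<Lambda>"
      using that by (auto simp: K_def PiE_iff multipliers_def extensional_def split: if_splits)
    moreover have "pos_def (inv_spectrum Q \<theta>)" if \<theta>: "\<theta> \<in> torus_grid N" for \<theta>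
    proof (rule pos_def_of_psd_nonsingular)
      show "hermitian (inv_spectrum Q \<theta>)"
        unfolding inv_spectrum_def
        by (intro hermitian_add pos_def_hermitian pos_def_matrix_inv prior \<theta>
            hermitian_trig_poly finite_freqs uminus_freqs mult)
      show "quad_form (inv_spectrum Q \<theta>) x \<ge> 0" for x
        using \<open>Q \<in> K\<close> \<theta> by (simp add: K_def)
      have "m \<theta> \<le> Re (det (inv_spectrum Q \<theta>))"
        using \<open>Q \<in> K\<close> \<theta> by (simp add: K_def)
      with m(2)[of \<theta>] show "det (inv_spectrum Q \<theta>) \<noteq> 0" by auto
    qed
    ultimately show ?thesis by (simp add: mem_L)
  qed
  have "continuous_on K J"
    using KL by (intro continuous_on_dual_fun pos_def_det) (simp add: mem_L)
  moreover have "K \<noteq> {}" using sub[OF Q0] by auto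
  ultimately obtain Q where Q: "Q \<in> K" "\<And>Q'. Q' \<in> K \<Longrightarrow> J Q \<le> J Q'"
    using continuous_attains_inf[OF \<open>compact K\<close>] by metis
  \<comment> \<open>If \<open>Q'\<close> lies outside the sublevel set, then \<open>J Q'\<close>
    exceeds \<open>J Q0\<close>, which is at least \<open>J Q\<close>.\<close>
  have "J Q \<le> J Q'" if "Q' \<in> L" for Q'
    using Q(2)[of Q'] Q(2)[of Q0] sub[OF that] sub[OF Q0] by force
  with KL[OF Q(1)] show ?thesis by blast
qed

lemma dual_minimizer_unique:
  assumes "Q \<in> L" "Q' \<in> L" and minimal: "\<And>Q''. Q'' \<in> L \<Longrightarrow> J Q \<le> J Q''" and "J Q' \<le> J Q"
  shows "Q = Q'"
proof (rule inv_spectrum_eqD[OF assms(1,2)])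
  fix \<theta> assume \<theta>: "\<theta> \<in> torus_grid N"
  define \<Phi> where "\<Phi> \<theta> = matrix_inv (inv_spectrum Q \<theta>)" for \<theta>
  have feas: "feasible \<Lambda> N S \<Phi>"
    unfolding \<Phi>_def by (intro dual_minimizer_feasible assms)
  have pd: "pos_def (inv_spectrum Q \<theta>)" "pos_def (inv_spectrum Q' \<theta>)" "pos_def (\<Phi> \<theta>)"
    if "\<theta> \<in> torus_grid N" for \<theta>
    using assms(1,2) feas that by (auto simp: mem_L feasible_def)
  have "J Q' = J Q"
    using minimal[OF assms(2)] assms(4) by simp
  \<comment> \<open>The same \<Phi> is used with both multipliers, so equal dual values mean equal
    average gaps; for \<open>Q\<close> the gap is zero at every grid point.\<close>
  then have "grid_avg N (gap \<Phi> Q') = grid_avg N (gap \<Phi> Q)"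
    using divergence_plus_dual_fun[OF feas, of Q] divergence_plus_dual_fun[OF feas, of Q'] by simp
  also have "\<dots> = grid_avg N (\<lambda>_. 0)"
    unfolding \<Phi>_def by (intro grid_avg_cong gap_inverse pd)
  also have "\<dots> = 0"
    by (simp add: grid_avg_def)
  finally have avg: "grid_avg N (gap \<Phi> Q') = 0" .
  have "gap \<Phi> Q' \<theta> = 0"
    by (rule grid_avg_eq_0[OF gap_nonneg N_pos \<theta> avg]) (simp_all add: pd)
  then have "inv_spectrum Q' \<theta> ** \<Phi> \<theta> = mat 1"
    by (intro gap_eq_0 pd \<theta>)
  then have "matrix_inv (inv_spectrum Q' \<theta>) = matrix_inv (inv_spectrum Q \<theta>)"
    unfolding \<Phi>_def by (rule matrix_inv_unique)
  then show "inv_spectrum Q \<theta> = inv_spectrum Q' \<theta>"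
    using matrix_inv_matrix_inv[OF pd(1)[OF \<theta>]] matrix_inv_matrix_inv[OF pd(2)[OF \<theta>]] by metis
qed

text \<open>For fixed \<open>Q\<close>, the divergences of two feasible functions differ exactly by
  their average gaps, and the inverse of \<open>inv_spectrum Q\<close> has gap zero.\<close>

lemma primal_optimal:
  assumes "Q \<in> L" and minimal: "\<And>Q'. Q' \<in> L \<Longrightarrow> J Q \<le> J Q'" and "feasible \<Lambda> N S \<Phi>"
  shows "divergence N (\<lambda>\<theta>. matrix_inv (inv_spectrum Q \<theta>)) \<Psi> \<le> divergence N \<Phi> \<Psi>"
proof -
  have "grid_avg N (gap (\<lambda>\<theta>. matrix_inv (inv_spectrum Q \<theta>)) Q) \<le> grid_avg N (gap \<Phi> Q)"
  proof (rule grid_avg_mono)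
    fix \<theta> assume "\<theta> \<in> torus_grid N"
    then have "pos_def (inv_spectrum Q \<theta>)" "pos_def (\<Phi> \<theta>)"
      using assms by (auto simp: mem_L feasible_def)
    then show "gap (\<lambda>\<theta>. matrix_inv (inv_spectrum Q \<theta>)) Q \<theta> \<le> gap \<Phi> Q \<theta>"
      by (simp add: gap_inverse gap_nonneg)
  qed
  then show ?thesis
    using divergence_plus_dual_fun[OF assms(3), of Q]
      divergence_plus_dual_fun[OF dual_minimizer_feasible[OF assms(1) minimal], of Q] by simp
qed

end

theorem theorem1:
  fixes \<Lambda> :: "(int ^ 'd) set"
    and N :: "nat ^ 'd"
    and \<Psi> :: "real ^ 'd \<Rightarrow> complex ^ 'm ^ 'm"
    and S :: "int ^ 'd \<Rightarrow> complex ^ 'm ^ 'm"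
  assumes "finite \<Lambda>" and "0 \<in> \<Lambda>" and "\<And>k. k \<in> \<Lambda> \<Longrightarrow> - k \<in> \<Lambda>"
    and "\<And>j. N $ j > 0"
    and "\<And>j. int (N $ j) > 2 * max_index \<Lambda> j"
    and "\<And>\<theta>. \<theta> \<in> torus_grid N \<Longrightarrow> pos_def (\<Psi> \<theta>)"
    and "\<exists>\<Phi>\<^sub>0. feasible \<Lambda> N S \<Phi>\<^sub>0"
  shows "(\<exists>!Q. is_arg_min (dual_fun \<Lambda> N \<Psi> S) (\<lambda>Q. Q \<in> L_plus \<Lambda> N \<Psi>) Q) \<and>
    (\<forall>Q. is_arg_min (dual_fun \<Lambda> N \<Psi> S) (\<lambda>Q. Q \<in> L_plus \<Lambda> N \<Psi>) Q \<longrightarrow>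
       is_arg_min (\<lambda>\<Phi>. divergence N \<Phi> \<Psi>) (feasible \<Lambda> N S)
         (\<lambda>\<theta>. matrix_inv (matrix_inv (\<Psi> \<theta>) + trig_poly \<Lambda> Q \<theta>)))"
proof -
  interpret moment_problem \<Lambda> N \<Psi> S
    using assms by unfold_locales auto
  have arg_min: "is_arg_min J (\<lambda>Q. Q \<in> L) Q \<longleftrightarrow> Q \<in> L \<and> (\<forall>Q'\<in>L. J Q \<le> J Q')" for Q
    by (auto simp: is_arg_min_def not_less)
  have "\<exists>!Q. is_arg_min J (\<lambda>Q. Q \<in> L) Q"
    using dual_minimizer_exists dual_minimizer_unique unfolding arg_min by metis
  moreover have "is_arg_min (\<lambda>\<Phi>. divergence N \<Phi> \<Psi>) (feasible \<Lambda> N S)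
      (\<lambda>\<theta>. matrix_inv (inv_spectrum Q \<theta>))" if "is_arg_min J (\<lambda>Q. Q \<in> L) Q" for Q
    using that dual_minimizer_feasible[of Q] primal_optimal[of Q]
    unfolding arg_min is_arg_min_def by (auto simp: not_less)
  ultimately show ?thesis
    by (simp add: inv_spectrum_def)
qed

end
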